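(* (i) Every global type which is regular (over some small set) and asymmetric is orthogonal to every invariant symmetric global type. (ii) Among regular global types, both symmetry and asymmetry are preserved under non-orthogonality: if $\mathfrak p,\mathfrak q$ are regular and not orthogonal, then $\mathfrak p$ is symmetric iff $\mathfrak q$ is symmetric. (iii) Non-orthogonality is an equivalence relation on the set of asymmetric regular global types.
   Context: Monster model $\mathfrak C$ of a complete theory. A global type is invariant if it does not split over some small set. $\mathfrak p$ is regular over a small $A$ if it is non-algebraic, $A$-invariant, and for all $B\supseteq A$ and $a\models\mathfrak p_{\restriction A}$, either $a\models\mathfrak p_{\restriction B}$ or $\mathfrak p_{\restriction B}\vdash\mathfrak p_{\restriction Ba}$; regular means regular over some small set. For invariant global types, $\mathfrak p(\bar x)\otimes\mathfrak q(\bar y)={\rm tp}(\bar a,\bar b/\mathfrak C)$ where $\bar a\models\mathfrak p$, $\bar b\models\mathfrak q_{\restriction\mathfrak C\bar a}$; $\mathfrak p$ is symmetric if $\mathfrak p(\bar x)\otimes\mathfrak p(\bar y)=\mathfrak p(\bar y)\otimes\mathfrak p(\bar x)$, asymmetric otherwise. Global types $\mathfrak p(\bar x),\mathfrak q(\bar y)$ are orthogonal if $\mathfrak p(\bar x)\cup\mathfrak q(\bar y)$ determines a complete type over $\mathfrak C$. *)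

theory Defs
  imports Main
begin

section \<open>First-order formulas with parameters\<close>

text \<open>
  Variables are de Bruijn indices: in a formula in \<open>n\<close> free variables these are
  \<open>Var 0, \<dots>, Var (n - 1)\<close>.  \<open>Par a\<close> is the constant symbol naming the element \<open>a\<close>, so a formula
  with parameters in \<open>B\<close> is one whose set \<open>pars_fm\<close> is contained in \<open>B\<close>.
\<close>

record ('f, 'r) lang =
  fsyms :: "'f set"
  rsyms :: "'r set"
  farity :: "'f \<Rightarrow> nat"
  rarity :: "'r \<Rightarrow> nat"

datatype (dead 'f, pars_tm: 'a) tm =
    Var nat
  | Par 'a
  | Fn 'f "('f, 'a) tm list"
  for map: map_tm

datatype (dead 'f, dead 'r, pars_fm: 'a) fm =
    Equ "('f, 'a) tm" "('f, 'a) tm"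
  | Rel 'r "('f, 'a) tm list"
  | Neg "('f, 'r, 'a) fm"
  | Conj "('f, 'r, 'a) fm" "('f, 'r, 'a) fm"
  | Exi "('f, 'r, 'a) fm"
  for map: map_fm

primrec wf_tm :: "('f, 'r) lang \<Rightarrow> ('f, 'a) tm \<Rightarrow> bool" where
  "wf_tm L (Var i) \<longleftrightarrow> True"
| "wf_tm L (Par a) \<longleftrightarrow> True"
| "wf_tm L (Fn f ts) \<longleftrightarrow> f \<in> fsyms L \<and> length ts = farity L f \<and> list_all (wf_tm L) ts"

primrec wf_fm :: "('f, 'r) lang \<Rightarrow> ('f, 'r, 'a) fm \<Rightarrow> bool" where
  "wf_fm L (Equ s t) \<longleftrightarrow> wf_tm L s \<and> wf_tm L t"
| "wf_fm L (Rel R ts) \<longleftrightarrow> R \<in> rsyms L \<and> length ts = rarity L R \<and> list_all (wf_tm L) ts"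
| "wf_fm L (Neg \<phi>) \<longleftrightarrow> wf_fm L \<phi>"
| "wf_fm L (Conj \<phi> \<psi>) \<longleftrightarrow> wf_fm L \<phi> \<and> wf_fm L \<psi>"
| "wf_fm L (Exi \<phi>) \<longleftrightarrow> wf_fm L \<phi>"

primrec fv_tm :: "('f, 'a) tm \<Rightarrow> nat set" where
  "fv_tm (Var i) = {i}"
| "fv_tm (Par a) = {}"
| "fv_tm (Fn f ts) = \<Union> (set (map fv_tm ts))"

primrec fv_fm :: "('f, 'r, 'a) fm \<Rightarrow> nat set" where
  "fv_fm (Equ s t) = fv_tm s \<union> fv_tm t"
| "fv_fm (Rel R ts) = \<Union> (set (map fv_tm ts))"
| "fv_fm (Neg \<phi>) = fv_fm \<phi>"
| "fv_fm (Conj \<phi> \<psi>) = fv_fm \<phi> \<union> fv_fm \<psi>"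
| "fv_fm (Exi \<phi>) = {i. Suc i \<in> fv_fm \<phi>}"

primrec subst_tm :: "(nat \<Rightarrow> ('f, 'a) tm) \<Rightarrow> ('f, 'a) tm \<Rightarrow> ('f, 'a) tm" where
  "subst_tm \<sigma> (Var i) = \<sigma> i"
| "subst_tm \<sigma> (Par a) = Par a"
| "subst_tm \<sigma> (Fn f ts) = Fn f (map (subst_tm \<sigma>) ts)"

primrec subst_fm :: "(nat \<Rightarrow> ('f, 'a) tm) \<Rightarrow> ('f, 'r, 'a) fm \<Rightarrow> ('f, 'r, 'a) fm" where
  "subst_fm \<sigma> (Equ s t) = Equ (subst_tm \<sigma> s) (subst_tm \<sigma> t)"
| "subst_fm \<sigma> (Rel R ts) = Rel R (map (subst_tm \<sigma>) ts)"
| "subst_fm \<sigma> (Neg \<phi>) = Neg (subst_fm \<sigma> \<phi>)"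
| "subst_fm \<sigma> (Conj \<phi> \<psi>) = Conj (subst_fm \<sigma> \<phi>) (subst_fm \<sigma> \<psi>)"
| "subst_fm \<sigma> (Exi \<phi>) =
    Exi (subst_fm (case_nat (Var 0) (\<lambda>i. subst_tm (\<lambda>j. Var (Suc j)) (\<sigma> i))) \<phi>)"

definition rename :: "(nat \<Rightarrow> nat) \<Rightarrow> ('f, 'r, 'a) fm \<Rightarrow> ('f, 'r, 'a) fm" where
  "rename \<rho> = subst_fm (\<lambda>i. Var (\<rho> i))"

text \<open>
  For \<open>\<phi>(x\<^sub>0, \<dots>, x\<^sub>n\<^sub>-\<^sub>1, y\<^sub>0, y\<^sub>1, \<dots>)\<close>, \<open>inst n \<phi> ds\<close> is \<open>\<phi>(x\<^sub>0, \<dots>, x\<^sub>n\<^sub>-\<^sub>1, ds)\<close>.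
\<close>

definition inst :: "nat \<Rightarrow> ('f, 'r, 'a) fm \<Rightarrow> 'a list \<Rightarrow> ('f, 'r, 'a) fm" where
  "inst n \<phi> ds = subst_fm (\<lambda>i. if i < n then Var i else Par (ds ! (i - n))) \<phi>"

definition fmls :: "('f, 'r) lang \<Rightarrow> 'a set \<Rightarrow> nat \<Rightarrow> ('f, 'r, 'a) fm set" where
  "fmls L B n = {\<phi>. wf_fm L \<phi> \<and> pars_fm \<phi> \<subseteq> B \<and> fv_fm \<phi> \<subseteq> {..<n}}"


section \<open>Structures and types\<close>

record ('f, 'r, 'a) fostruct =
  univ :: "'a set"
  fint :: "'f \<Rightarrow> 'a list \<Rightarrow> 'a"
  rint :: "'r \<Rightarrow> 'a list \<Rightarrow> bool"

definition is_struct :: "('f, 'r) lang \<Rightarrow> ('f, 'r, 'a) fostruct \<Rightarrow> bool" where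
  "is_struct L M \<longleftrightarrow> univ M \<noteq> {} \<and>
    (\<forall>f\<in>fsyms L. \<forall>xs. set xs \<subseteq> univ M \<and> length xs = farity L f \<longrightarrow> fint M f xs \<in> univ M)"

primrec eval :: "('f, 'r, 'a) fostruct \<Rightarrow> (nat \<Rightarrow> 'a) \<Rightarrow> ('f, 'a) tm \<Rightarrow> 'a" where
  "eval M e (Var i) = e i"
| "eval M e (Par a) = a"
| "eval M e (Fn f ts) = fint M f (map (eval M e) ts)"

primrec sat :: "('f, 'r, 'a) fostruct \<Rightarrow> (nat \<Rightarrow> 'a) \<Rightarrow> ('f, 'r, 'a) fm \<Rightarrow> bool" where
  "sat M e (Equ s t) \<longleftrightarrow> eval M e s = eval M e t"
| "sat M e (Rel R ts) \<longleftrightarrow> rint M R (map (eval M e) ts)"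
| "sat M e (Neg \<phi>) \<longleftrightarrow> \<not> sat M e \<phi>"
| "sat M e (Conj \<phi> \<psi>) \<longleftrightarrow> sat M e \<phi> \<and> sat M e \<psi>"
| "sat M e (Exi \<phi>) \<longleftrightarrow> (\<exists>x\<in>univ M. sat M (case_nat x e) \<phi>)"

definition holds :: "('f, 'r, 'a) fostruct \<Rightarrow> 'a list \<Rightarrow> ('f, 'r, 'a) fm \<Rightarrow> bool" where
  "holds M xs \<phi> \<longleftrightarrow> sat M (\<lambda>i. xs ! i) \<phi>"

definition tuples :: "nat \<Rightarrow> 'a set \<Rightarrow> 'a list set" where
  "tuples n B = {xs. length xs = n \<and> set xs \<subseteq> B}"

definition realizes ::
  "('f, 'r, 'a) fostruct \<Rightarrow> nat \<Rightarrow> 'a list \<Rightarrow> ('f, 'r, 'a) fm set \<Rightarrow> bool" where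
  "realizes M n xs p \<longleftrightarrow> xs \<in> tuples n (univ M) \<and> (\<forall>\<phi>\<in>p. holds M xs \<phi>)"

definition tp ::
  "('f, 'r) lang \<Rightarrow> ('f, 'r, 'a) fostruct \<Rightarrow> 'a list \<Rightarrow> 'a set \<Rightarrow> ('f, 'r, 'a) fm set" where
  "tp L M xs B = {\<phi> \<in> fmls L B (length xs). holds M xs \<phi>}"

text \<open>\<open>Stp L M n B\<close> is \<open>S\<^sub>n(B)\<close>, the set of complete \<open>n\<close>-types over \<open>B\<close>.\<close>

definition Stp ::
  "('f, 'r) lang \<Rightarrow> ('f, 'r, 'a) fostruct \<Rightarrow> nat \<Rightarrow> 'a set \<Rightarrow> ('f, 'r, 'a) fm set set" where
  "Stp L M n B = {p. p \<subseteq> fmls L B n \<and>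
    (\<forall>F. finite F \<and> F \<subseteq> p \<longrightarrow> (\<exists>xs. realizes M n xs F)) \<and>
    (\<forall>\<phi>\<in>fmls L B n. \<phi> \<in> p \<or> Neg \<phi> \<in> p)}"

definition elem_emb ::
  "('f, 'r) lang \<Rightarrow> ('f, 'r, 'a) fostruct \<Rightarrow> ('f, 'r, 'b) fostruct \<Rightarrow> ('a \<Rightarrow> 'b) \<Rightarrow> bool" where
  "elem_emb L M N h \<longleftrightarrow> is_struct L N \<and> h ` univ M \<subseteq> univ N \<and>
    (\<forall>\<phi>\<in>fmls L (univ M) 0. holds M [] \<phi> \<longleftrightarrow> holds N [] (map_fm h \<phi>))"

definition partial_elem ::
  "('f, 'r) lang \<Rightarrow> ('f, 'r, 'a) fostruct \<Rightarrow> 'a set \<Rightarrow> ('a \<Rightarrow> 'a) \<Rightarrow> bool" where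
  "partial_elem L M A h \<longleftrightarrow> A \<subseteq> univ M \<and> h ` A \<subseteq> univ M \<and>
    (\<forall>\<phi>\<in>fmls L A 0. holds M [] \<phi> \<longleftrightarrow> holds M [] (map_fm h \<phi>))"

definition automorphism ::
  "('f, 'r) lang \<Rightarrow> ('f, 'r, 'a) fostruct \<Rightarrow> ('a \<Rightarrow> 'a) \<Rightarrow> bool" where
  "automorphism L M g \<longleftrightarrow> bij_betw g (univ M) (univ M) \<and>
    (\<forall>f\<in>fsyms L. \<forall>xs\<in>tuples (farity L f) (univ M). g (fint M f xs) = fint M f (map g xs)) \<and>
    (\<forall>R\<in>rsyms L. \<forall>xs\<in>tuples (rarity L R) (univ M). rint M R xs \<longleftrightarrow> rint M R (map g xs))"


section \<open>Monster models\<close>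

definition small :: "('f, 'r, 'a) fostruct \<Rightarrow> 'k rel \<Rightarrow> 'a set \<Rightarrow> bool" where
  "small M \<kappa> A \<longleftrightarrow> A \<subseteq> univ M \<and> (card_of A, \<kappa>) \<in> ordLess"

text \<open>
  A monster model: \<open>\<kappa>\<close>-saturated and strongly \<open>\<kappa>\<close>-homogeneous for a cardinal \<open>\<kappa>\<close> larger than
  the number of formulas; the complete theory is the theory of \<open>M\<close>.
\<close>

definition monster ::
  "('f, 'r) lang \<Rightarrow> ('f, 'r, 'a) fostruct \<Rightarrow> 'k rel \<Rightarrow> bool" where
  "monster L M \<kappa> \<longleftrightarrow> is_struct L M \<and> Card_order \<kappa> \<and>
    (card_of {\<phi> :: ('f, 'r, 'a) fm. wf_fm L \<phi> \<and> pars_fm \<phi> = {}}, \<kappa>) \<in> ordLess \<and>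
    (\<forall>A n. small M \<kappa> A \<longrightarrow> (\<forall>p\<in>Stp L M n A. \<exists>xs. realizes M n xs p)) \<and>
    (\<forall>A h. small M \<kappa> A \<and> partial_elem L M A h \<longrightarrow>
      (\<exists>g. automorphism L M g \<and> (\<forall>x\<in>A. g x = h x)))"


section \<open>Global types\<close>

text \<open>A type in \<open>n\<close> variables is carried along with \<open>n\<close>.\<close>

type_synonym ('f, 'r, 'a) ntype = "nat \<times> ('f, 'r, 'a) fm set"

definition global_type ::
  "('f, 'r) lang \<Rightarrow> ('f, 'r, 'a) fostruct \<Rightarrow> ('f, 'r, 'a) ntype \<Rightarrow> bool" where
  "global_type L M P \<longleftrightarrow> snd P \<in> Stp L M (fst P) (univ M)"

definition restr :: "('f, 'r, 'a) fm set \<Rightarrow> 'a set \<Rightarrow> ('f, 'r, 'a) fm set" where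
  "restr p B = {\<phi> \<in> p. pars_fm \<phi> \<subseteq> B}"

definition algebraic :: "('f, 'r, 'a) fostruct \<Rightarrow> ('f, 'r, 'a) ntype \<Rightarrow> bool" where
  "algebraic M P \<longleftrightarrow> (\<exists>\<phi>\<in>snd P. finite {xs \<in> tuples (fst P) (univ M). holds M xs \<phi>})"

definition splits ::
  "('f, 'r) lang \<Rightarrow> ('f, 'r, 'a) fostruct \<Rightarrow> 'a set \<Rightarrow> ('f, 'r, 'a) ntype \<Rightarrow> bool" where
  "splits L M A P \<longleftrightarrow> (\<exists>k. \<exists>\<phi>\<in>fmls L {} (fst P + k).
    \<exists>as\<in>tuples k (univ M). \<exists>bs\<in>tuples k (univ M).
      tp L M as A = tp L M bs A \<and> inst (fst P) \<phi> as \<in> snd P \<and> inst (fst P) \<phi> bs \<notin> snd P)"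

definition invariant_over ::
  "('f, 'r) lang \<Rightarrow> ('f, 'r, 'a) fostruct \<Rightarrow> 'a set \<Rightarrow> ('f, 'r, 'a) ntype \<Rightarrow> bool" where
  "invariant_over L M A P \<longleftrightarrow> global_type L M P \<and> \<not> splits L M A P"

definition invariant ::
  "('f, 'r) lang \<Rightarrow> ('f, 'r, 'a) fostruct \<Rightarrow> 'k rel \<Rightarrow> ('f, 'r, 'a) ntype \<Rightarrow> bool" where
  "invariant L M \<kappa> P \<longleftrightarrow> (\<exists>A. small M \<kappa> A \<and> invariant_over L M A P)"

definition regular_over ::
  "('f, 'r) lang \<Rightarrow> ('f, 'r, 'a) fostruct \<Rightarrow> 'k rel \<Rightarrow> 'a set \<Rightarrow> ('f, 'r, 'a) ntype \<Rightarrow> bool" where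
  "regular_over L M \<kappa> A P \<longleftrightarrow> \<not> algebraic M P \<and> invariant_over L M A P \<and>
    (\<forall>B a. small M \<kappa> B \<and> A \<subseteq> B \<and> realizes M (fst P) a (restr (snd P) A) \<longrightarrow>
      realizes M (fst P) a (restr (snd P) B) \<or>
      (\<forall>c. realizes M (fst P) c (restr (snd P) B) \<longrightarrow>
           realizes M (fst P) c (restr (snd P) (B \<union> set a))))"

definition regular ::
  "('f, 'r) lang \<Rightarrow> ('f, 'r, 'a) fostruct \<Rightarrow> 'k rel \<Rightarrow> ('f, 'r, 'a) ntype \<Rightarrow> bool" where
  "regular L M \<kappa> P \<longleftrightarrow> (\<exists>A. small M \<kappa> A \<and> regular_over L M \<kappa> A P)"

text \<open>
  Let \<open>Q\<close> be an \<open>A\<close>-invariant global type of \<open>M\<close>, \<open>h\<close> an elementary embedding of \<open>M\<close> into \<open>N\<close>, and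
  \<open>B\<close> a set of elements of \<open>N\<close>.  Then \<open>ext_restr L M A N h Q B\<close> is the restriction to \<open>B\<close> of the
  \<open>A\<close>-invariant extension of \<open>Q\<close>: a formula \<open>\<phi>(y, d)\<close> with \<open>d\<close> in \<open>B\<close> belongs to it iff \<open>\<phi>(y, d')\<close>
  belongs to \<open>Q\<close> for a tuple \<open>d'\<close> of \<open>M\<close> having the same type over \<open>A\<close> as \<open>d\<close>.
\<close>

definition ext_restr ::
  "('f, 'r) lang \<Rightarrow> ('f, 'r, 'a) fostruct \<Rightarrow> 'a set \<Rightarrow> ('f, 'r, 'b) fostruct \<Rightarrow> ('a \<Rightarrow> 'b) \<Rightarrow>
    ('f, 'r, 'a) ntype \<Rightarrow> 'b set \<Rightarrow> ('f, 'r, 'b) fm set" where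
  "ext_restr L M A N h Q B =
    {inst (fst Q) (map_fm h \<phi>) d | k \<phi> d d'.
      \<phi> \<in> fmls L {} (fst Q + k) \<and> d \<in> tuples k B \<and> d' \<in> tuples k (univ M) \<and>
      tp L N d (h ` A) = map_fm h ` tp L M d' A \<and> inst (fst Q) \<phi> d' \<in> snd Q}"

text \<open>
  \<open>P(x) \<otimes> Q(y) = tp(a, b / M)\<close> for \<open>a\<close> realizing \<open>P\<close> and \<open>b\<close> realizing the restriction of \<open>Q\<close> to
  \<open>M \<union> a\<close>.  The realizations live in an elementary extension \<open>N\<close> of \<open>M\<close>; the result depends neither
  on \<open>N\<close>, \<open>a\<close>, \<open>b\<close> nor on the small set \<open>A\<close> over which \<open>Q\<close> is invariant.  The element type of \<open>N\<close>
  is large enough for suitable realizations to exist: every complete \<open>k\<close>-type over \<open>M\<close> is realized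
  in an ultrapower of \<open>M\<close> with the set of \<open>k\<close>-tuples as index set, and the elements of such an
  ultrapower are represented by functions from lists over \<open>M\<close> to \<open>M\<close>.
\<close>

definition tensor ::
  "('f, 'r) lang \<Rightarrow> ('f, 'r, 'a) fostruct \<Rightarrow> 'k rel \<Rightarrow>
    ('f, 'r, 'a) ntype \<Rightarrow> ('f, 'r, 'a) ntype \<Rightarrow> ('f, 'r, 'a) fm set" where
  "tensor L M \<kappa> P Q =
    {\<phi> \<in> fmls L (univ M) (fst P + fst Q).
      \<exists>(N :: ('f, 'r, 'a list \<Rightarrow> 'a) fostruct) h a b A.
        elem_emb L M N h \<and> small M \<kappa> A \<and> invariant_over L M A Q \<and>
        realizes N (fst P) a (map_fm h ` snd P) \<and>
        realizes N (fst Q) b (ext_restr L M A N h Q (h ` univ M \<union> set a)) \<and>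
        holds N (a @ b) (map_fm h \<phi>)}"

text \<open>
  In \<open>P(x) \<otimes> P(y)\<close> the variables are \<open>x = (Var 0, \<dots>, Var (n - 1))\<close> and
  \<open>y = (Var n, \<dots>, Var (2 n - 1))\<close>; \<open>P(y) \<otimes> P(x)\<close> arises from it by exchanging the two blocks.
\<close>

definition symmetric ::
  "('f, 'r) lang \<Rightarrow> ('f, 'r, 'a) fostruct \<Rightarrow> 'k rel \<Rightarrow> ('f, 'r, 'a) ntype \<Rightarrow> bool" where
  "symmetric L M \<kappa> P \<longleftrightarrow>
    tensor L M \<kappa> P P =
    rename (\<lambda>i. if i < fst P then i + fst P else i - fst P) ` tensor L M \<kappa> P P"

definition asymmetric ::
  "('f, 'r) lang \<Rightarrow> ('f, 'r, 'a) fostruct \<Rightarrow> 'k rel \<Rightarrow> ('f, 'r, 'a) ntype \<Rightarrow> bool" where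
  "asymmetric L M \<kappa> P \<longleftrightarrow> \<not> symmetric L M \<kappa> P"

definition orthogonal ::
  "('f, 'r) lang \<Rightarrow> ('f, 'r, 'a) fostruct \<Rightarrow> ('f, 'r, 'a) ntype \<Rightarrow> ('f, 'r, 'a) ntype \<Rightarrow> bool" where
  "orthogonal L M P Q \<longleftrightarrow>
    (\<exists>!r. r \<in> Stp L M (fst P + fst Q) (univ M) \<and>
          snd P \<union> rename (\<lambda>i. i + fst P) ` snd Q \<subseteq> r)"

end

theory Submission
  imports Defs
begin

text \<open>
  Write \<open>a \<Turnstile> p|B\<close> for realization inside the monster model, and let \<open>p\<close> be regular over \<open>A\<close> and asymmetric,
  witnessed by a formula over \<open>A\<close>.  Then \<open>b \<Turnstile> p|Aa\<close> excludes \<open>a \<Turnstile> p|Ab\<close>, so \<open>a < b \<longleftrightarrow> b \<Turnstile> p|Aa\<close> is a strict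
  order on the realizations of \<open>p|A\<close>, and by regularity \<open>D(b) = {a \<Turnstile> p|A. a \<Turnstile> p|Ab fails}\<close> is an
  initial segment lying below every realization of \<open>p|Ab\<close>, for any tuple \<open>b\<close>.
  If \<open>q\<close> is not orthogonal to \<open>p\<close>, then \<open>b \<Turnstile> q|Ac\<close> forces \<open>c \<in> D(b)\<close> for every \<open>c \<Turnstile> p|A\<close>.  Hence
  for \<open>b\<^sub>1, b\<^sub>2\<close> realizing \<open>q \<otimes> q\<close> over \<open>A\<close> the segment \<open>D(b\<^sub>1)\<close> is strictly smaller than \<open>D(b\<^sub>2)\<close>, which is
  impossible if \<open>b\<^sub>1\<close> and \<open>b\<^sub>2\<close> can be exchanged by an automorphism, that is, if \<open>q\<close> is symmetric.
  For transitivity one shows that, for non-orthogonal \<open>p\<close> and \<open>q\<close>, a realization of \<open>q|A\<close> that does not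
  realize \<open>q|B\<close> cannot raise \<open>D\<close> above \<open>B\<close>: every \<open>a \<Turnstile> p|B\<close> still realizes \<open>p|Bb\<close>.  If
  \<open>a \<Turnstile> p|A\<close>, \<open>b \<Turnstile> q|Aa\<close>, \<open>c \<Turnstile> r|Aab\<close> and \<open>p\<close> were orthogonal to \<open>r\<close>, then \<open>a \<Turnstile> p|Ac\<close>, whence \<open>a \<Turnstile> p|Ab\<close>,
  contradicting \<open>a \<in> D(b)\<close>.
\<close>

section \<open>Substitution and satisfaction\<close>

text \<open>Variables and parameters are replaced at once, and the parameter type may change.
  \<open>subst_fm\<close>, \<open>map_fm\<close> and the turning of parameters into variables are
  then instances of one operation, covered by the single lemma \<open>satp_psub\<close>.\<close>

primrec psub_tm ::
  "(nat \<Rightarrow> ('f, 'a) tm) \<Rightarrow> ('b \<Rightarrow> ('f, 'a) tm) \<Rightarrow> ('f, 'b) tm \<Rightarrow> ('f, 'a) tm" where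
  "psub_tm \<sigma> \<pi> (Var i) = \<sigma> i"
| "psub_tm \<sigma> \<pi> (Par b) = \<pi> b"
| "psub_tm \<sigma> \<pi> (Fn f ts) = Fn f (map (psub_tm \<sigma> \<pi>) ts)"

abbreviation shift :: "('f, 'a) tm \<Rightarrow> ('f, 'a) tm" where
  "shift \<equiv> subst_tm (\<lambda>j. Var (Suc j))"

primrec psub_fm ::
  "(nat \<Rightarrow> ('f, 'a) tm) \<Rightarrow> ('b \<Rightarrow> ('f, 'a) tm) \<Rightarrow> ('f, 'r, 'b) fm \<Rightarrow> ('f, 'r, 'a) fm" where
  "psub_fm \<sigma> \<pi> (Equ s t) = Equ (psub_tm \<sigma> \<pi> s) (psub_tm \<sigma> \<pi> t)"
| "psub_fm \<sigma> \<pi> (Rel R ts) = Rel R (map (psub_tm \<sigma> \<pi>) ts)"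
| "psub_fm \<sigma> \<pi> (Neg \<phi>) = Neg (psub_fm \<sigma> \<pi> \<phi>)"
| "psub_fm \<sigma> \<pi> (Conj \<phi> \<psi>) = Conj (psub_fm \<sigma> \<pi> \<phi>) (psub_fm \<sigma> \<pi> \<psi>)"
| "psub_fm \<sigma> \<pi> (Exi \<phi>) =
    Exi (psub_fm (case_nat (Var 0) (\<lambda>i. shift (\<sigma> i))) (\<lambda>b. shift (\<pi> b)) \<phi>)"

text \<open>Parameters are read through a valuation \<open>v\<close> instead of as themselves. Thus
  a formula over \<open>M\<close> can be evaluated in an extension \<open>N\<close> along an
  embedding without being rewritten.\<close>

primrec evalp :: "('f, 'r, 'a) fostruct \<Rightarrow> (nat \<Rightarrow> 'a) \<Rightarrow> ('b \<Rightarrow> 'a) \<Rightarrow> ('f, 'b) tm \<Rightarrow> 'a" where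
  "evalp M e v (Var i) = e i"
| "evalp M e v (Par b) = v b"
| "evalp M e v (Fn f ts) = fint M f (map (evalp M e v) ts)"

primrec satp :: "('f, 'r, 'a) fostruct \<Rightarrow> (nat \<Rightarrow> 'a) \<Rightarrow> ('b \<Rightarrow> 'a) \<Rightarrow> ('f, 'r, 'b) fm \<Rightarrow> bool" where
  "satp M e v (Equ s t) \<longleftrightarrow> evalp M e v s = evalp M e v t"
| "satp M e v (Rel R ts) \<longleftrightarrow> rint M R (map (evalp M e v) ts)"
| "satp M e v (Neg \<phi>) \<longleftrightarrow> \<not> satp M e v \<phi>"
| "satp M e v (Conj \<phi> \<psi>) \<longleftrightarrow> satp M e v \<phi> \<and> satp M e v \<psi>"
| "satp M e v (Exi \<phi>) \<longleftrightarrow> (\<exists>x\<in>univ M. satp M (case_nat x e) v \<phi>)"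

definition tms :: "('f, 'r) lang \<Rightarrow> 'a set \<Rightarrow> nat \<Rightarrow> ('f, 'a) tm set" where
  "tms L B n = {t. wf_tm L t \<and> pars_tm t \<subseteq> B \<and> fv_tm t \<subseteq> {..<n}}"

lemma subst_tm_psub: "subst_tm \<sigma> t = psub_tm \<sigma> Par t"
  by (induction t) auto

lemma subst_fm_psub: "subst_fm \<sigma> \<phi> = psub_fm \<sigma> Par \<phi>"
  by (induction \<phi> arbitrary: \<sigma>) (auto simp: subst_tm_psub)

lemma map_tm_psub: "map_tm h t = psub_tm Var (\<lambda>b. Par (h b)) t"
  by (induction t) auto

lemma case_nat_Var_Suc [simp]: "case_nat (Var 0) (\<lambda>i. Var (Suc i)) = Var"
  by (rule ext) (simp split: nat.split)

lemma map_fm_psub: "map_fm h \<phi> = psub_fm Var (\<lambda>b. Par (h b)) \<phi>"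
  by (induction \<phi>) (auto simp: map_tm_psub)

lemma eval_evalp: "eval M e t = evalp M e (\<lambda>a. a) t"
  by (induction t) (auto cong: map_cong)

lemma map_eval_evalp: "map (eval M e) ts = map (evalp M e (\<lambda>a. a)) ts"
  by (simp add: eval_evalp)

lemma sat_satp: "sat M e \<phi> \<longleftrightarrow> satp M e (\<lambda>a. a) \<phi>"
  by (induction \<phi> arbitrary: e) (auto simp: eval_evalp map_eval_evalp)

lemma evalp_psub:
  "evalp M e v (psub_tm \<sigma> \<pi> t) = evalp M (\<lambda>i. evalp M e v (\<sigma> i)) (\<lambda>b. evalp M e v (\<pi> b)) t"
  by (induction t) (auto simp: comp_def cong: map_cong)

lemma evalp_shift [simp]: "evalp M (case_nat x e) v (shift t) = evalp M e v t"
  by (simp add: subst_tm_psub evalp_psub)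

lemma satp_psub:
  "satp M e v (psub_fm \<sigma> \<pi> \<phi>) \<longleftrightarrow> satp M (\<lambda>i. evalp M e v (\<sigma> i)) (\<lambda>b. evalp M e v (\<pi> b)) \<phi>"
proof (induction \<phi> arbitrary: e \<sigma> \<pi>)
  case (Exi \<phi>)
  have "(\<lambda>i. evalp M (case_nat x e) v (case i of 0 \<Rightarrow> Var 0 | Suc i \<Rightarrow> shift (\<sigma> i))) =
    case_nat x (\<lambda>i. evalp M e v (\<sigma> i))" for x
    by (rule ext) (simp split: nat.split)
  then show ?case by (simp add: Exi.IH)
qed (auto simp: evalp_psub comp_def)

lemma evalp_cong:
  assumes "\<And>i. i \<in> fv_tm t \<Longrightarrow> e i = e' i" "\<And>b. b \<in> pars_tm t \<Longrightarrow> v b = v' b"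
  shows "evalp M e v t = evalp M e' v' t"
  using assms by (induction t) (force intro!: arg_cong[where f = "fint M _"])+

lemma satp_cong:
  assumes "\<And>i. i \<in> fv_fm \<phi> \<Longrightarrow> e i = e' i" "\<And>b. b \<in> pars_fm \<phi> \<Longrightarrow> v b = v' b"
  shows "satp M e v \<phi> \<longleftrightarrow> satp M e' v' \<phi>"
  using assms
proof (induction \<phi> arbitrary: e e')
  case (Equ s t)
  then have "evalp M e v s = evalp M e' v' s" "evalp M e v t = evalp M e' v' t"
    by (auto intro!: evalp_cong)
  then show ?case by simp
next
  case (Rel R ts)
  then have "map (evalp M e v) ts = map (evalp M e' v') ts"
    by (auto intro!: evalp_cong)
  then show ?case by (simp only: satp.simps)
next
  case (Neg \<phi>)
  have "satp M e v \<phi> \<longleftrightarrow> satp M e' v' \<phi>" by (rule Neg.IH) (use Neg.prems in auto)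
  then show ?case by simp
next
  case (Conj \<phi> \<psi>)
  have "satp M e v \<phi> \<longleftrightarrow> satp M e' v' \<phi>" "satp M e v \<psi> \<longleftrightarrow> satp M e' v' \<psi>"
    by (rule Conj.IH; use Conj.prems in auto)+
  then show ?case by simp
next
  case (Exi \<phi>)
  have "satp M (case_nat x e) v \<phi> \<longleftrightarrow> satp M (case_nat x e') v' \<phi>" for x
    by (rule Exi.IH) (use Exi.prems in \<open>auto split: nat.split\<close>)
  then show ?case by simp
qed

lemma satp_cong_fmls:
  assumes "\<phi> \<in> fmls L B n" "\<And>i. i < n \<Longrightarrow> e i = e' i" "\<And>b. b \<in> B \<Longrightarrow> v b = v' b"
  shows "satp M e v \<phi> \<longleftrightarrow> satp M e' v' \<phi>"
  using assms by (intro satp_cong) (auto simp: fmls_def)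

lemma tms_simps [simp]:
  "Var i \<in> tms L B n \<longleftrightarrow> i < n" "Par b \<in> tms L B n \<longleftrightarrow> b \<in> B"
  "Fn f ts \<in> tms L B n \<longleftrightarrow> f \<in> fsyms L \<and> length ts = farity L f \<and> set ts \<subseteq> tms L B n"
  by (auto simp: tms_def list_all_iff)

lemma fmls_simps [simp]:
  "Equ s t \<in> fmls L B n \<longleftrightarrow> s \<in> tms L B n \<and> t \<in> tms L B n"
  "Rel R ts \<in> fmls L B n \<longleftrightarrow> R \<in> rsyms L \<and> length ts = rarity L R \<and> set ts \<subseteq> tms L B n"
  "Neg \<phi> \<in> fmls L B n \<longleftrightarrow> \<phi> \<in> fmls L B n"
  "Conj \<phi> \<psi> \<in> fmls L B n \<longleftrightarrow> \<phi> \<in> fmls L B n \<and> \<psi> \<in> fmls L B n"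
  "Exi \<phi> \<in> fmls L B n \<longleftrightarrow> \<phi> \<in> fmls L B (Suc n)"
  by (auto simp: tms_def fmls_def list_all_iff subset_eq)
    (metis Suc_less_eq less_Suc_eq_0_disj not0_implies_Suc)

lemma psub_tms:
  assumes "t \<in> tms L B n" "\<And>i. i < n \<Longrightarrow> \<sigma> i \<in> tms L C m" "\<And>b. b \<in> B \<Longrightarrow> \<pi> b \<in> tms L C m"
  shows "psub_tm \<sigma> \<pi> t \<in> tms L C m"
  using assms by (induction t) auto

lemma shift_tms: "t \<in> tms L C m \<Longrightarrow> shift t \<in> tms L C (Suc m)"
  unfolding subst_tm_psub by (erule psub_tms) auto

lemma psub_fmls:
  assumes "\<phi> \<in> fmls L B n" "\<And>i. i < n \<Longrightarrow> \<sigma> i \<in> tms L C m" "\<And>b. b \<in> B \<Longrightarrow> \<pi> b \<in> tms L C m"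
  shows "psub_fm \<sigma> \<pi> \<phi> \<in> fmls L C m"
  using assms
proof (induction \<phi> arbitrary: n m \<sigma> \<pi>)
  case (Exi \<phi>)
  then show ?case
    by (auto intro!: Exi.IH[where n = "Suc n"] shift_tms split: nat.split)
qed (auto intro: psub_tms)

lemma fmls_mono: "\<phi> \<in> fmls L B n \<Longrightarrow> B \<subseteq> C \<Longrightarrow> n \<le> m \<Longrightarrow> \<phi> \<in> fmls L C m"
  by (fastforce simp: fmls_def)

lemma map_fm_fmls: "\<phi> \<in> fmls L B n \<Longrightarrow> h ` B \<subseteq> C \<Longrightarrow> map_fm h \<phi> \<in> fmls L C n"
  unfolding map_fm_psub by (erule psub_fmls) auto

lemma satp_map_fm: "satp M e v (map_fm h \<phi>) \<longleftrightarrow> satp M e (\<lambda>b. v (h b)) \<phi>"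
  by (simp add: map_fm_psub satp_psub)

lemma finite_pars_tm: "finite (pars_tm t)"
  by (induction t) auto

lemma finite_pars_fm: "finite (pars_fm \<phi>)"
  by (induction \<phi>) (auto simp: finite_pars_tm)

lemma fmls_pars: "\<phi> \<in> fmls L B n \<Longrightarrow> \<phi> \<in> fmls L (pars_fm \<phi>) n"
  by (auto simp: fmls_def)

lemma holds_satp: "holds M xs \<phi> \<longleftrightarrow> satp M ((!) xs) (\<lambda>a. a) \<phi>"
  by (simp add: holds_def sat_satp)

lemma holds_append:
  assumes "\<phi> \<in> fmls L B n" "length xs = n"
  shows "holds M (xs @ ys) \<phi> \<longleftrightarrow> holds M xs \<phi>"
  unfolding holds_satp
  by (rule satp_cong_fmls[OF assms(1)]) (auto simp: nth_append assms(2))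

lemma rename_fmls:
  assumes "\<phi> \<in> fmls L B n" "\<And>i. i < n \<Longrightarrow> \<rho> i < m"
  shows "rename \<rho> \<phi> \<in> fmls L B m"
  unfolding rename_def subst_fm_psub by (rule psub_fmls[OF assms(1)]) (use assms(2) in auto)

lemma satp_rename: "satp M e v (rename \<rho> \<phi>) \<longleftrightarrow> satp M (\<lambda>i. e (\<rho> i)) v \<phi>"
  by (simp add: rename_def subst_fm_psub satp_psub)

lemma inst_fmls:
  assumes "\<phi> \<in> fmls L B (n + k)" "ds \<in> tuples k C" "B \<subseteq> C"
  shows "inst n \<phi> ds \<in> fmls L C n"
  unfolding inst_def subst_fm_psub
  by (rule psub_fmls[OF assms(1)]) (use assms(2,3) in \<open>auto simp: tuples_def\<close>)

lemma satp_inst: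
  "satp M e v (inst n \<phi> ds) \<longleftrightarrow> satp M (\<lambda>i. if i < n then e i else v (ds ! (i - n))) v \<phi>"
  by (auto simp: inst_def subst_fm_psub satp_psub if_distrib cong: if_cong)

lemma holds_inst:
  assumes "\<phi> \<in> fmls L B (n + k)" "length xs = n"
  shows "holds M xs (inst n \<phi> ds) \<longleftrightarrow> holds M (xs @ ds) \<phi>"
  unfolding holds_satp satp_inst
  by (rule satp_cong_fmls[OF assms(1)]) (auto simp: nth_append assms(2))

text \<open>Each parameter in \<open>ds\<close> becomes a variable numbered from \<open>n\<close>
  on. Displaying \<open>ds\<close> as arguments in this way allows it to be exchanged later for a
  conjugate tuple.\<close>

lemma abstract_parameters:
  fixes \<phi> :: "('f, 'r, 'b) fm" and M :: "('f, 'r, 'a) fostruct"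
  assumes "\<phi> \<in> fmls L (B \<union> set ds) n"
  obtains \<phi>' where "\<phi>' \<in> fmls L B (n + length ds)"
    "\<forall>e v. satp M e v \<phi> \<longleftrightarrow>
       satp M (\<lambda>i. if i < n then e i else v (ds ! (i - n))) v \<phi>'"
proof -
  have "\<forall>b\<in>set ds. \<exists>j < length ds. ds ! j = b" by (auto simp: in_set_conv_nth)
  \<comment> \<open>An element may occur several times in \<open>ds\<close>; any position serves,
    since all of them carry the same value.\<close>
  then obtain k where k: "\<And>b. b \<in> set ds \<Longrightarrow> k b < length ds \<and> ds ! k b = b" by metis
  define \<pi> :: "'b \<Rightarrow> ('f, 'b) tm" where "\<pi> b = (if b \<in> set ds then Var (n + k b) else Par b)" for b
  define \<phi>' :: "('f, 'r, 'b) fm" where "\<phi>' = psub_fm Var \<pi> \<phi>"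
  show thesis
  proof
    show "\<phi>' \<in> fmls L B (n + length ds)"
      unfolding \<phi>'_def by (rule psub_fmls[OF assms]) (use k in \<open>auto simp: \<pi>_def\<close>)
    show "\<forall>e v. satp M e v \<phi> \<longleftrightarrow> satp M (\<lambda>i. if i < n then e i else v (ds ! (i - n))) v \<phi>'"
      unfolding \<phi>'_def satp_psub
      by (intro allI satp_cong_fmls[OF assms]) (use k in \<open>auto simp: \<pi>_def\<close>)
  qed
qed

section \<open>Equalities between renamed formulas\<close>

lemma case_nat_Var_comp:
  "case_nat (Var 0) (\<lambda>i. Var (Suc (\<rho> i))) = (\<lambda>i. Var (case i of 0 \<Rightarrow> 0 | Suc i \<Rightarrow> Suc (\<rho> i)))"
  by (rule ext) (simp split: nat.split)

text \<open>Proved as an equality of formulas, not only up to equivalence, because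
  \<open>symmetric\<close> compares sets of formulas.\<close>

lemma rename_rename:
  fixes \<phi> :: "('f, 'r, 'a) fm"
  shows "rename \<rho> (rename \<rho>' \<phi>) = rename (\<lambda>i. \<rho> (\<rho>' i)) \<phi>"
proof -
  have tm: "subst_tm (\<lambda>i. Var (\<rho> i)) (subst_tm (\<lambda>i. Var (\<rho>' i)) t) =
    subst_tm (\<lambda>i. Var (\<rho> (\<rho>' i))) t" for \<rho> \<rho>' and t :: "('f, 'a) tm"
    by (induction t) auto
  have comp: "(case case i of 0 \<Rightarrow> 0 | Suc i \<Rightarrow> Suc (\<rho>' i) of 0 \<Rightarrow> 0 | Suc i \<Rightarrow> Suc (\<rho> i)) =
    (case i of 0 \<Rightarrow> 0 | Suc i \<Rightarrow> Suc (\<rho> (\<rho>' i)))" for \<rho> \<rho>' :: "nat \<Rightarrow> nat" and i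
    by (simp split: nat.split)
  show ?thesis unfolding rename_def
    by (induction \<phi> arbitrary: \<rho> \<rho>') (auto simp: tm comp case_nat_Var_comp)
qed

lemma pars_rename:
  fixes \<phi> :: "('f, 'r, 'a) fm"
  shows "pars_fm (rename \<rho> \<phi>) = pars_fm \<phi>"
proof -
  have tm: "pars_tm (subst_tm (\<lambda>i. Var (\<rho> i)) t) = pars_tm t" for \<rho> and t :: "('f, 'a) tm"
    by (induction t) auto
  show ?thesis unfolding rename_def
    by (induction \<phi> arbitrary: \<rho>) (auto simp: tm case_nat_Var_comp)
qed

lemma rename_id:
  fixes \<phi> :: "('f, 'r, 'a) fm"
  assumes "\<phi> \<in> fmls L B n" "\<And>i. i < n \<Longrightarrow> \<rho> i = i"
  shows "rename \<rho> \<phi> = \<phi>"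
proof -
  have tm: "subst_tm \<sigma> t = t" if "t \<in> tms L B n" "\<And>i. i < n \<Longrightarrow> \<sigma> i = Var i"
    for t n and \<sigma> :: "nat \<Rightarrow> ('f, 'a) tm"
    using that by (induction t) (auto intro: map_idI)
  have "subst_fm \<sigma> \<phi> = \<phi>" if "\<phi> \<in> fmls L B n" "\<And>i. i < n \<Longrightarrow> \<sigma> i = Var i" for \<sigma> n
    using that
  proof (induction \<phi> arbitrary: \<sigma> n)
    case (Exi \<phi>)
    then show ?case
      by (auto intro!: Exi.IH[where n = "Suc n"] split: nat.split)
  next
    case (Rel R ts)
    then show ?case by (auto intro!: map_idI tm)
  qed (auto intro: tm)
  then show ?thesis unfolding rename_def using assms by auto
qed

section \<open>Ultrapowers\<close>

text \<open>The equivalence for intersections covers both closure properties: read from left to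
  right it gives upward closure, from right to left closure under finite intersections.\<close>

definition ultrafilter :: "'i set set \<Rightarrow> bool" where
  "ultrafilter U \<longleftrightarrow> {} \<notin> U \<and> UNIV \<in> U \<and> (\<forall>X Y. X \<inter> Y \<in> U \<longleftrightarrow> X \<in> U \<and> Y \<in> U) \<and>
    (\<forall>X. - X \<in> U \<longleftrightarrow> X \<notin> U)"

text \<open>By Zorn's lemma there is a maximal family containing \<open>G\<close> with the finite
  intersection property, and maximality makes it an ultrafilter.\<close>

lemma ultrafilter_extends:
  assumes "\<And>F. finite F \<Longrightarrow> F \<subseteq> G \<Longrightarrow> \<Inter>F \<noteq> {}"
  obtains U where "ultrafilter U" "G \<subseteq> U"
proof -
  define \<A> where "\<A> = {U. G \<subseteq> U \<and> (\<forall>F. finite F \<and> F \<subseteq> U \<longrightarrow> \<Inter>F \<noteq> {})}"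
  have "G \<in> \<A>" using assms by (auto simp: \<A>_def)
  have "\<exists>U\<in>\<A>. \<forall>X\<in>\<A>. U \<subseteq> X \<longrightarrow> X = U"
  proof (rule subset_Zorn_nonempty)
    show "\<A> \<noteq> {}" using \<open>G \<in> \<A>\<close> by blast
    fix C assume C: "C \<noteq> {}" "subset.chain \<A> C"
    have "\<Inter>F \<noteq> {}" if F: "finite F" "F \<subseteq> \<Union>C" for F
    proof -
      obtain X where "X \<in> C" "F \<subseteq> X"
        using finite_subset_Union_chain[OF F C] .
      then show ?thesis using C(2) F(1) by (auto simp: \<A>_def subset.chain_def)
    qed
    moreover have "G \<subseteq> \<Union>C" using C by (fastforce simp: \<A>_def subset.chain_def)
    ultimately show "\<Union>C \<in> \<A>" by (auto simp: \<A>_def)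
  qed
  then obtain U where U: "U \<in> \<A>" and max: "\<And>X. X \<in> \<A> \<Longrightarrow> U \<subseteq> X \<Longrightarrow> X = U" by blast
  have fip: "\<Inter>F \<noteq> {}" if "finite F" "F \<subseteq> U" for F using U that by (auto simp: \<A>_def)
  \<comment> \<open>The form in which maximality is used: a set that meets all finite intersections
    from \<open>U\<close> can be added to \<open>U\<close>, hence already belongs to it.\<close>
  have in_U: "X \<in> U" if "\<And>F. finite F \<Longrightarrow> F \<subseteq> U \<Longrightarrow> X \<inter> \<Inter>F \<noteq> {}" for X
  proof -
    have "\<Inter>F \<noteq> {}" if F: "finite F" "F \<subseteq> insert X U" for F
    proof -
      have "X \<inter> \<Inter>(F - {X}) \<noteq> {}" using F by (intro \<open>\<And>F. _ \<Longrightarrow> _ \<Longrightarrow> X \<inter> \<Inter>F \<noteq> {}\<close>) auto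
      moreover have "X \<inter> \<Inter>(F - {X}) \<subseteq> \<Inter>F" by blast
      ultimately show ?thesis by blast
    qed
    then have "insert X U \<in> \<A>" using U by (auto simp: \<A>_def)
    then show ?thesis using max[of "insert X U"] by blast
  qed
  have up: "Y \<in> U" if "X \<in> U" "X \<subseteq> Y" for X Y
  proof (rule in_U)
    fix F assume "finite F" "F \<subseteq> U"
    then have "\<Inter>(insert X F) \<noteq> {}" using that by (intro fip) auto
    then show "Y \<inter> \<Inter>F \<noteq> {}" using that by auto
  qed
  have inter: "X \<inter> Y \<in> U" if "X \<in> U" "Y \<in> U" for X Y
  proof (rule in_U)
    fix F assume "finite F" "F \<subseteq> U"
    then have "\<Inter>(insert X (insert Y F)) \<noteq> {}" using that by (intro fip) auto
    then show "X \<inter> Y \<inter> \<Inter>F \<noteq> {}" by auto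
  qed
  \<comment> \<open>If neither set belongs to \<open>U\<close>, each is missed by some finite
    intersection from \<open>U\<close>, and the two intersections together would be empty.\<close>
  have "X \<in> U \<or> - X \<in> U" for X
  proof (rule ccontr)
    assume *: "\<not> (X \<in> U \<or> - X \<in> U)"
    obtain F1 where 1: "finite F1" "F1 \<subseteq> U" "X \<inter> \<Inter>F1 = {}" using in_U[of X] * by blast
    obtain F2 where 2: "finite F2" "F2 \<subseteq> U" "- X \<inter> \<Inter>F2 = {}" using in_U[of "- X"] * by blast
    have "\<Inter>(F1 \<union> F2) \<noteq> {}" using 1 2 by (intro fip) auto
    then show False using 1(3) 2(3) by auto
  qed
  moreover have "\<not> (X \<in> U \<and> - X \<in> U)" for X using fip[of "{X, - X}"] by auto
  moreover have "{} \<notin> U" using fip[of "{{}}"] by auto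
  moreover have "UNIV \<in> U" by (rule in_U) (use fip in auto)
  moreover have "X \<in> U \<and> Y \<in> U" if "X \<inter> Y \<in> U" for X Y using up[OF that] by blast
  ultimately have "ultrafilter U" unfolding ultrafilter_def using inter by blast
  then show thesis using that U by (auto simp: \<A>_def)
qed

section \<open>The ultrapower and the theorem of Los\<close>

locale ultrapower =
  fixes L :: "('f, 'r) lang" and M :: "('f, 'r, 'a) fostruct" and U :: "'i set set"
  assumes struct: "is_struct L M" and ultra: "ultrafilter U"
begin

definition ev :: "('i \<Rightarrow> bool) \<Rightarrow> bool" where
  "ev P \<longleftrightarrow> {i. P i} \<in> U"

lemma ev_const [simp]: "ev (\<lambda>_. c) \<longleftrightarrow> c"
  using ultra by (auto simp: ev_def ultrafilter_def)

lemma ev_conj: "ev (\<lambda>i. P i \<and> Q i) \<longleftrightarrow> ev P \<and> ev Q"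
  using ultra by (simp add: ev_def ultrafilter_def Collect_conj_eq)

lemma ev_not: "ev (\<lambda>i. \<not> P i) \<longleftrightarrow> \<not> ev P"
  using ultra by (simp add: ev_def ultrafilter_def Collect_neg_eq)

lemma ev_mono:
  assumes "ev P" "\<And>i. P i \<Longrightarrow> Q i"
  shows "ev Q"
proof -
  have "ev (\<lambda>i. P i \<and> Q i)" using assms by (metis (mono_tags, lifting) ev_def Collect_cong)
  then show ?thesis by (simp add: ev_conj)
qed

lemma ev_iff:
  assumes "ev (\<lambda>i. P i \<longleftrightarrow> Q i)"
  shows "ev P \<longleftrightarrow> ev Q"
proof -
  have "ev (\<lambda>i. (P i \<longleftrightarrow> Q i) \<and> P i) \<longleftrightarrow> ev (\<lambda>i. (P i \<longleftrightarrow> Q i) \<and> Q i)"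
    by (rule arg_cong[where f = ev]) auto
  then show ?thesis using assms by (simp add: ev_conj)
qed

lemma ev_list: "(\<And>x. x \<in> set xs \<Longrightarrow> ev (P x)) \<Longrightarrow> ev (\<lambda>i. \<forall>x\<in>set xs. P x i)"
  by (induction xs) (auto simp: ev_conj)

text \<open>A chosen representative of the class of \<open>f\<close> modulo \<open>U\<close>. The
  elements of the ultrapower are thereby functions rather than classes, as the element type in
  \<open>tensor\<close> demands.\<close>

definition rep :: "('i \<Rightarrow> 'a) \<Rightarrow> 'i \<Rightarrow> 'a" where
  "rep f = (SOME g. range g \<subseteq> univ M \<and> ev (\<lambda>i. g i = f i))"

definition N :: "('f, 'r, 'i \<Rightarrow> 'a) fostruct" where
  "N = \<lparr>univ = rep ` {f. range f \<subseteq> univ M},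
        fint = \<lambda>f gs. rep (\<lambda>i. fint M f (map (\<lambda>g. g i) gs)),
        rint = \<lambda>R gs. ev (\<lambda>i. rint M R (map (\<lambda>g. g i) gs))\<rparr>"

lemma rep:
  assumes "range f \<subseteq> univ M"
  shows "range (rep f) \<subseteq> univ M" "ev (\<lambda>i. rep f i = f i)"
proof -
  have "range (rep f) \<subseteq> univ M \<and> ev (\<lambda>i. rep f i = f i)"
    unfolding rep_def by (rule someI[of _ f]) (use assms in auto)
  then show "range (rep f) \<subseteq> univ M" "ev (\<lambda>i. rep f i = f i)" by auto
qed

lemma rep_cong:
  assumes "ev (\<lambda>i. f i = g i)"
  shows "rep f = rep g"
proof -
  have "ev (\<lambda>i. k i = f i) \<longleftrightarrow> ev (\<lambda>i. k i = g i)" for k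
    by (rule ev_iff) (rule ev_mono[OF assms], auto)
  then show ?thesis by (simp add: rep_def)
qed

lemma rep_in_N: "range f \<subseteq> univ M \<Longrightarrow> rep f \<in> univ N"
  by (auto simp: N_def)

lemma univ_N:
  assumes "x \<in> univ N"
  shows "range x \<subseteq> univ M" "rep x = x"
proof -
  obtain f where f: "x = rep f" "range f \<subseteq> univ M" using assms by (auto simp: N_def)
  show "range x \<subseteq> univ M" using rep[OF f(2)] f(1) by simp
  show "rep x = x" using rep_cong[OF rep(2)[OF f(2)]] f(1) by simp
qed

lemma eq_iff_ev: "x \<in> univ N \<Longrightarrow> y \<in> univ N \<Longrightarrow> x = y \<longleftrightarrow> ev (\<lambda>i. x i = y i)"
  using rep_cong[of x y] univ_N(2) by auto

text \<open>Function symbols act in \<open>N\<close> through a representative, so values of terms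
  agree with the coordinatewise ones only almost everywhere.\<close>

lemma Los_tm:
  assumes "wf_tm L t" "range e \<subseteq> univ N" "range v \<subseteq> univ N"
  shows "evalp N e v t \<in> univ N \<and> ev (\<lambda>i. evalp N e v t i = evalp M (\<lambda>j. e j i) (\<lambda>b. v b i) t)"
  using assms(1)
proof (induction t)
  case (Fn f ts)
  have IH: "evalp N e v t \<in> univ N \<and> ev (\<lambda>i. evalp N e v t i = evalp M (\<lambda>j. e j i) (\<lambda>b. v b i) t)"
    if "t \<in> set ts" for t using Fn that by (auto simp: list_all_iff)
  define F where "F i = fint M f (map (\<lambda>t. evalp N e v t i) ts)" for i
  have F: "evalp N e v (Fn f ts) = rep F" by (simp add: N_def F_def[abs_def] comp_def)
  have "F i \<in> univ M" for i
  proof -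
    have "set (map (\<lambda>t. evalp N e v t i) ts) \<subseteq> univ M" using IH univ_N(1) by fastforce
    then show ?thesis using struct Fn.prems unfolding is_struct_def F_def by auto
  qed
  then have "range F \<subseteq> univ M" by auto
  moreover have "ev (\<lambda>i. F i = evalp M (\<lambda>j. e j i) (\<lambda>b. v b i) (Fn f ts))"
    by (rule ev_mono[OF ev_list[of ts "\<lambda>t i. evalp N e v t i = evalp M (\<lambda>j. e j i) (\<lambda>b. v b i) t"]])
      (use IH in \<open>auto simp: F_def cong: map_cong\<close>)
  ultimately show ?case unfolding F using rep[of F] rep_in_N[of F]
    by (auto simp: ev_conj intro: ev_mono[where P = "\<lambda>i. rep F i = F i \<and> F i = evalp M (\<lambda>j. e j i) (\<lambda>b. v b i) (Fn f ts)"])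
qed (use assms(2,3) in auto)

text \<open>The theorem of Los, with the parameters interpreted by elements of \<open>N\<close>.
  Only the quantifier needs an idea: witnesses are chosen coordinate by coordinate.\<close>

lemma Los:
  assumes "wf_fm L \<phi>" "range e \<subseteq> univ N" "range v \<subseteq> univ N"
  shows "satp N e v \<phi> \<longleftrightarrow> ev (\<lambda>i. satp M (\<lambda>j. e j i) (\<lambda>b. v b i) \<phi>)"
  using assms(1,2)
proof (induction \<phi> arbitrary: e)
  case (Equ s t)
  note s = Los_tm[OF _ Equ.prems(2) assms(3), of s] and t = Los_tm[OF _ Equ.prems(2) assms(3), of t]
  have "satp N e v (Equ s t) \<longleftrightarrow> ev (\<lambda>i. evalp N e v s i = evalp N e v t i)"
    using s t Equ.prems by (simp add: eq_iff_ev)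
  also have "\<dots> \<longleftrightarrow> ev (\<lambda>i. satp M (\<lambda>j. e j i) (\<lambda>b. v b i) (Equ s t))"
    by (rule ev_iff, rule ev_mono[where P = "\<lambda>i. evalp N e v s i = evalp M (\<lambda>j. e j i) (\<lambda>b. v b i) s \<and>
      evalp N e v t i = evalp M (\<lambda>j. e j i) (\<lambda>b. v b i) t"]) (use s t Equ.prems in \<open>auto simp: ev_conj\<close>)
  finally show ?case .
next
  case (Rel R ts)
  have "satp N e v (Rel R ts) \<longleftrightarrow> ev (\<lambda>i. rint M R (map (\<lambda>t. evalp N e v t i) ts))"
    by (simp add: N_def comp_def)
  also have "\<dots> \<longleftrightarrow> ev (\<lambda>i. satp M (\<lambda>j. e j i) (\<lambda>b. v b i) (Rel R ts))"
  proof (rule ev_iff, rule ev_mono)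
    show "ev (\<lambda>i. \<forall>t\<in>set ts. evalp N e v t i = evalp M (\<lambda>j. e j i) (\<lambda>b. v b i) t)"
      by (rule ev_list) (use Rel.prems Los_tm[OF _ Rel.prems(2) assms(3)] in \<open>auto simp: list_all_iff\<close>)
  qed (auto cong: map_cong)
  finally show ?case .
next
  case (Exi \<phi>)
  have cn: "(\<lambda>j. case_nat x e j i) = case_nat (x i) (\<lambda>j. e j i)" for x i
    by (rule ext) (simp split: nat.split)
  have IH: "satp N (case_nat x e) v \<phi> \<longleftrightarrow>
    ev (\<lambda>i. satp M (case_nat (x i) (\<lambda>j. e j i)) (\<lambda>b. v b i) \<phi>)" if "x \<in> univ N" for x
    using Exi.IH[of "case_nat x e"] that Exi.prems by (auto simp: cn image_subset_iff split: nat.split)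
  show ?case
  proof
    assume "satp N e v (Exi \<phi>)"
    then obtain x where x: "x \<in> univ N" "satp N (case_nat x e) v \<phi>" by auto
    then show "ev (\<lambda>i. satp M (\<lambda>j. e j i) (\<lambda>b. v b i) (Exi \<phi>))"
      unfolding IH[OF x(1)] using univ_N(1)[OF x(1)] by (auto elim!: ev_mono)
  next
    let ?P = "\<lambda>i x. x \<in> univ M \<and> satp M (case_nat x (\<lambda>j. e j i)) (\<lambda>b. v b i) \<phi>"
    assume *: "ev (\<lambda>i. satp M (\<lambda>j. e j i) (\<lambda>b. v b i) (Exi \<phi>))"
    obtain u where u: "u \<in> univ M" using struct by (auto simp: is_struct_def)
    \<comment> \<open>Coordinates without a witness get the default \<open>u\<close>, which keeps
      \<open>f\<close> inside the universe; the hypothesis says that almost all coordinates have a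
      witness.\<close>
    define f where "f i = (if Ex (?P i) then SOME x. ?P i x else u)" for i
    have f: "?P i (f i)" if "Ex (?P i)" for i
      using someI_ex[OF that] that by (simp add: f_def)
    have "f i \<in> univ M" for i using f[of i] u by (cases "Ex (?P i)") (auto simp: f_def)
    then have rf: "range f \<subseteq> univ M" by auto
    have "ev (\<lambda>i. satp M (case_nat (rep f i) (\<lambda>j. e j i)) (\<lambda>b. v b i) \<phi>)"
      by (rule ev_mono[where P = "\<lambda>i. rep f i = f i \<and> satp M (\<lambda>j. e j i) (\<lambda>b. v b i) (Exi \<phi>)"])
        (use * rep(2)[OF rf] f in \<open>auto simp: ev_conj\<close>)
    then show "satp N e v (Exi \<phi>)" using IH[OF rep_in_N[OF rf]] rep_in_N[OF rf] by auto
  qed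
qed (auto simp: ev_conj ev_not)

lemma is_struct_N: "is_struct L N"
  unfolding is_struct_def
proof (intro conjI ballI allI impI)
  obtain u where "u \<in> univ M" using struct by (auto simp: is_struct_def)
  then show "univ N \<noteq> {}" using rep_in_N[of "\<lambda>_. u"] by auto
  fix f xs assume f: "f \<in> fsyms L" and xs: "set xs \<subseteq> univ N \<and> length xs = farity L f"
  have "fint M f (map (\<lambda>g. g i) xs) \<in> univ M" for i
  proof -
    have "set (map (\<lambda>g. g i) xs) \<subseteq> univ M" using xs univ_N(1) by auto
    then show ?thesis using struct f xs unfolding is_struct_def by auto
  qed
  then have "range (\<lambda>i. fint M f (map (\<lambda>g. g i) xs)) \<subseteq> univ M" by auto
  then show "fint N f xs \<in> univ N" by (simp add: N_def)
qed

end

text \<open>The index set consists of lists over \<open>M\<close>, and the ultrafilter contains the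
  solution set of every formula of \<open>r\<close>. The coordinate functions then realize
  \<open>r\<close>.\<close>

lemma ultrapower_realizes:
  fixes M :: "('f, 'r, 'a) fostruct"
  assumes "is_struct L M" and r: "r \<in> Stp L M k (univ M)"
  obtains N :: "('f, 'r, 'a list \<Rightarrow> 'a) fostruct" and h c
  where "elem_emb L M N h" "realizes N k c (map_fm h ` r)"
proof -
  \<comment> \<open>These solution sets have the finite intersection property because
    \<open>r\<close> is finitely satisfiable in \<open>M\<close>.\<close>
  define G where "G = (\<lambda>\<phi>. {xs \<in> tuples k (univ M). holds M xs \<phi>}) ` r"
  have fip: "\<Inter>F \<noteq> {}" if F: "finite F" "F \<subseteq> G" for F
  proof -
    from finite_subset_image[OF F(1) F(2)[unfolded G_def]]
    obtain F' where F': "F' \<subseteq> r \<and> finite F' \<and>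
      F = (\<lambda>\<phi>. {xs \<in> tuples k (univ M). holds M xs \<phi>}) ` F'" ..
    then obtain xs where "realizes M k xs F'" using r by (auto simp: Stp_def)
    then show ?thesis using F' by (auto simp: realizes_def)
  qed
  obtain U where U: "ultrafilter U" "G \<subseteq> U"
    by (rule ultrafilter_extends[of G]) (use fip in blast)+
  interpret ultrapower L M U using assms(1) U(1) by unfold_locales
  obtain u where u: "u \<in> univ M" using struct by (auto simp: is_struct_def)
  \<comment> \<open>The diagonal embedding. The default \<open>u\<close> outside the universe makes
    \<open>h\<close> map everything into \<open>N\<close>, as the valuation in \<open>Los\<close>
    must.\<close>
  define h where "h a = rep (\<lambda>_. if a \<in> univ M then a else u)" for a
  \<comment> \<open>The \<open>j\<close>-th coordinate function, made total by \<open>u\<close> on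
    lists that are not \<open>k\<close>-tuples.\<close>
  define cf where "cf j xs = (if xs \<in> tuples k (univ M) \<and> j < k then xs ! j else u)" for j xs
  define c where "c = map (\<lambda>j. rep (cf j)) [0..<k]"
  have hN: "range h \<subseteq> univ N" unfolding h_def using u by (auto intro!: rep_in_N)
  have ev_h: "ev (\<lambda>i. h a i = a)" if "a \<in> univ M" for a
    using rep(2)[of "\<lambda>_. a"] that by (auto simp: h_def image_subset_iff)
  have cf: "range (cf j) \<subseteq> univ M" for j
    using u by (auto simp: cf_def tuples_def)
  have c_set: "length c = k" "set c \<subseteq> univ N" by (auto simp: c_def intro!: rep_in_N cf)
  have los: "holds N xs (map_fm h \<phi>) \<longleftrightarrow>
      ev (\<lambda>i. satp M (\<lambda>j. (xs ! j) i) (\<lambda>a. a) \<phi>)"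
    if xs: "length xs = n" "set xs \<subseteq> univ N" and \<phi>: "\<phi> \<in> fmls L (univ M) n" for xs n \<phi>
  proof -
    define e where "e j = (if j < n then xs ! j else h u)" for j
    have e: "range e \<subseteq> univ N" using xs hN by (auto simp: e_def)
    obtain ps where ps: "set ps = pars_fm \<phi>" using finite_list[OF finite_pars_fm] by metis
    have "holds N xs (map_fm h \<phi>) \<longleftrightarrow> satp N e h \<phi>"
      unfolding holds_satp satp_map_fm by (rule satp_cong_fmls[OF \<phi>]) (auto simp: e_def)
    also have "\<dots> \<longleftrightarrow> ev (\<lambda>i. satp M (\<lambda>j. e j i) (\<lambda>b. h b i) \<phi>)"
      by (rule Los) (use \<phi> e hN in \<open>auto simp: fmls_def\<close>)
    also have "\<dots> \<longleftrightarrow> ev (\<lambda>i. satp M (\<lambda>j. (xs ! j) i) (\<lambda>a. a) \<phi>)"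
    \<comment> \<open>Each \<open>h b\<close> agrees with the constant \<open>b\<close> only almost
      everywhere; since \<open>\<phi>\<close> has finitely many parameters, they agree
      simultaneously for almost every index.\<close>
    proof (rule ev_iff, rule ev_mono)
      show "ev (\<lambda>i. \<forall>b\<in>set ps. h b i = b)"
        by (rule ev_list) (use ev_h \<phi> ps in \<open>auto simp: fmls_def\<close>)
      show "satp M (\<lambda>j. e j i) (\<lambda>b. h b i) \<phi> \<longleftrightarrow> satp M (\<lambda>j. (xs ! j) i) (\<lambda>a. a) \<phi>"
        if "\<forall>b\<in>set ps. h b i = b" for i
        by (rule satp_cong_fmls[OF fmls_pars[OF \<phi>]]) (use that ps in \<open>auto simp: e_def\<close>)
    qed
    finally show ?thesis .
  qed
  have "elem_emb L M N h" unfolding elem_emb_def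
  proof (intro conjI ballI)
    show "is_struct L N" by (rule is_struct_N)
    show "h ` univ M \<subseteq> univ N" using hN by auto
    fix \<phi> assume \<phi>: "\<phi> \<in> fmls L (univ M) 0"
    have "satp M (\<lambda>j. ([] ! j) i) (\<lambda>a. a) \<phi> \<longleftrightarrow> holds M [] \<phi>" for i :: "'a list"
      unfolding holds_satp by (rule satp_cong_fmls[OF \<phi>]) auto
    then show "holds M [] \<phi> \<longleftrightarrow> holds N [] (map_fm h \<phi>)" using los[of "[]" 0 \<phi>] \<phi> by simp
  qed
  moreover have "realizes N k c (map_fm h ` r)" unfolding realizes_def
  proof (intro conjI ballI)
    show "c \<in> tuples k (univ N)" using c_set by (auto simp: tuples_def)
    fix \<psi> assume "\<psi> \<in> map_fm h ` r"
    then obtain \<phi> where \<phi>: "\<psi> = map_fm h \<phi>" "\<phi> \<in> r" by auto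
    then have \<phi>': "\<phi> \<in> fmls L (univ M) k" using r by (auto simp: Stp_def)
    have 1: "ev (\<lambda>xs. xs \<in> tuples k (univ M) \<and> holds M xs \<phi>)"
      using U(2) \<phi>(2) by (auto simp: ev_def G_def)
    have 2: "ev (\<lambda>xs. \<forall>j\<in>set [0..<k]. rep (cf j) xs = cf j xs)"
      by (rule ev_list) (use rep(2) cf in auto)
    have "ev (\<lambda>xs. satp M (\<lambda>j. (c ! j) xs) (\<lambda>a. a) \<phi>)"
    proof (rule ev_mono[OF iffD2[OF ev_conj, OF conjI[OF 1 2]]])
      fix xs assume xs: "(xs \<in> tuples k (univ M) \<and> holds M xs \<phi>) \<and>
        (\<forall>j\<in>set [0..<k]. rep (cf j) xs = cf j xs)"
      have "satp M (\<lambda>j. (c ! j) xs) (\<lambda>a. a) \<phi> \<longleftrightarrow> holds M xs \<phi>"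
        unfolding holds_satp by (rule satp_cong_fmls[OF \<phi>']) (use xs in \<open>auto simp: c_def cf_def\<close>)
      then show "satp M (\<lambda>j. (c ! j) xs) (\<lambda>a. a) \<phi>" using xs by blast
    qed
    then show "holds N c \<psi>" using los[OF c_set \<phi>'] \<phi>(1) by simp
  qed
  ultimately show thesis using that by blast
qed

text \<open>An ultrafilter on lists containing the solution sets of all members of
  \<open>\<Sigma>\<close> decides every formula; the formulas whose solution set is large form the
  completion.\<close>

lemma complete_type_extends:
  assumes \<Sigma>: "\<Sigma> \<subseteq> fmls L B k"
    and fin: "\<And>F. finite F \<Longrightarrow> F \<subseteq> \<Sigma> \<Longrightarrow> \<exists>xs. realizes M k xs F"
  obtains r where "r \<in> Stp L M k B" "\<Sigma> \<subseteq> r"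
proof -
  define X where "X \<phi> = {xs \<in> tuples k (univ M). holds M xs \<phi>}" for \<phi>
  \<comment> \<open>The set of all \<open>k\<close>-tuples is added so that the complement of a
    solution set, cut down to tuples, is still large when the solution set is not.\<close>
  have fip: "\<Inter>F \<noteq> {}" if F: "finite F" "F \<subseteq> insert (tuples k (univ M)) (X ` \<Sigma>)" for F
  proof -
    have "finite (F - {tuples k (univ M)})" "F - {tuples k (univ M)} \<subseteq> X ` \<Sigma>" using F by auto
    from finite_subset_image[OF this]
    obtain F' where F': "F' \<subseteq> \<Sigma> \<and> finite F' \<and> F - {tuples k (univ M)} = X ` F'" ..
    then obtain xs where "realizes M k xs F'" using fin[of F'] by auto
    then have "xs \<in> tuples k (univ M) \<inter> \<Inter>(X ` F')" by (auto simp: realizes_def X_def)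
    then have "xs \<in> \<Inter>F" using conjunct2[OF conjunct2[OF F']] by blast
    then show ?thesis by blast
  qed
  obtain U where U: "ultrafilter U" "insert (tuples k (univ M)) (X ` \<Sigma>) \<subseteq> U"
    by (rule ultrafilter_extends[of "insert (tuples k (univ M)) (X ` \<Sigma>)"]) (use fip in blast)+
  define r where "r = {\<phi> \<in> fmls L B k. X \<phi> \<in> U}"
  have "\<exists>xs. realizes M k xs F" if "finite F" "F \<subseteq> r" for F
  proof -
    have "tuples k (univ M) \<inter> \<Inter>(X ` F) \<in> U"
      using that
    proof (induction F)
      case empty
      then show ?case using U(2) by simp
    next
      case (insert \<phi> F)
      then have "X \<phi> \<inter> (tuples k (univ M) \<inter> \<Inter>(X ` F)) \<in> U"
        using U(1) by (auto simp: ultrafilter_def r_def)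
      then show ?case by (simp add: Int_left_commute)
    qed
    then have "tuples k (univ M) \<inter> \<Inter>(X ` F) \<noteq> {}" using U(1) by (metis ultrafilter_def)
    then show ?thesis by (auto simp: realizes_def X_def)
  qed
  moreover have "Neg \<phi> \<in> r" if "\<phi> \<in> fmls L B k" "\<phi> \<notin> r" for \<phi>
  proof -
    have "- X \<phi> \<inter> tuples k (univ M) \<in> U" using that U by (auto simp: ultrafilter_def r_def)
    moreover have "X (Neg \<phi>) = - X \<phi> \<inter> tuples k (univ M)" by (auto simp: X_def holds_satp)
    ultimately show ?thesis using that by (simp add: r_def)
  qed
  ultimately have "r \<in> Stp L M k B" by (auto simp: Stp_def r_def)
  moreover have "\<Sigma> \<subseteq> r" using \<Sigma> U(2) by (auto simp: r_def)
  ultimately show thesis using that by blast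
qed

section \<open>Types in a monster model\<close>

lemma holds_Neg [simp]: "holds M xs (Neg \<phi>) \<longleftrightarrow> \<not> holds M xs \<phi>"
  by (simp add: holds_def)

lemma Stp_finite: "p \<in> Stp L M n B \<Longrightarrow> finite F \<Longrightarrow> F \<subseteq> p \<Longrightarrow> \<exists>xs. realizes M n xs F"
  by (simp add: Stp_def)

lemma Stp_Neg_iff:
  assumes "p \<in> Stp L M n B" "\<phi> \<in> fmls L B n"
  shows "Neg \<phi> \<in> p \<longleftrightarrow> \<phi> \<notin> p"
proof -
  have "\<not> ({\<phi>, Neg \<phi>} \<subseteq> p)"
  proof
    assume "{\<phi>, Neg \<phi>} \<subseteq> p"
    from Stp_finite[OF assms(1) _ this] obtain xs where "realizes M n xs {\<phi>, Neg \<phi>}" by auto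
    then show False by (simp add: realizes_def)
  qed
  then show ?thesis using assms by (auto simp: Stp_def)
qed

text \<open>A complete type is closed under consequences that hold in \<open>M\<close>, since
  otherwise a finite subset of two formulas would have no realization.\<close>

lemma Stp_equiv:
  assumes "p \<in> Stp L M n B" "\<phi> \<in> p" "\<psi> \<in> fmls L B n"
    "\<And>xs. xs \<in> tuples n (univ M) \<Longrightarrow> holds M xs \<phi> \<Longrightarrow> holds M xs \<psi>"
  shows "\<psi> \<in> p"
proof (rule ccontr)
  assume "\<psi> \<notin> p"
  then have "{\<phi>, Neg \<psi>} \<subseteq> p" using assms by (auto simp: Stp_Neg_iff)
  from Stp_finite[OF assms(1) _ this] obtain xs where "realizes M n xs {\<phi>, Neg \<psi>}" by auto
  then show False using assms(4) by (auto simp: realizes_def)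
qed

lemma Stp_restr:
  assumes "p \<in> Stp L M n B" "C \<subseteq> B"
  shows "restr p C \<in> Stp L M n C"
proof -
  have "\<phi> \<in> restr p C \<or> Neg \<phi> \<in> restr p C" if "\<phi> \<in> fmls L C n" for \<phi>
    using assms that fmls_mono[OF that assms(2) order_refl]
    by (auto simp: Stp_def restr_def fmls_def)
  then show ?thesis using assms by (auto simp: Stp_def restr_def fmls_def)
qed

section \<open>Automorphisms preserve satisfaction\<close>

lemma automorphism_eval:
  assumes "is_struct L M" "automorphism L M g" "t \<in> tms L B n" "\<And>i. i < n \<Longrightarrow> e i \<in> univ M"
    "\<And>b. b \<in> B \<Longrightarrow> v b \<in> univ M"
  shows "evalp M e v t \<in> univ M \<and> evalp M (\<lambda>i. g (e i)) (\<lambda>b. g (v b)) t = g (evalp M e v t)"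
  using assms(3)
proof (induction t)
  case (Fn f ts)
  let ?xs = "map (evalp M e v) ts"
  have "?xs \<in> tuples (farity L f) (univ M)" using Fn by (auto simp: tuples_def)
  moreover have "map (evalp M (\<lambda>i. g (e i)) (\<lambda>b. g (v b))) ts = map g ?xs" using Fn by auto
  ultimately show ?case
    using assms(1,2) Fn.prems unfolding is_struct_def automorphism_def
    by (auto simp: tuples_def simp del: map_map)
qed (use assms(4,5) in auto)

lemma automorphism_satp:
  assumes "is_struct L M" "automorphism L M g" "\<phi> \<in> fmls L B n" "\<And>i. i < n \<Longrightarrow> e i \<in> univ M"
    "\<And>b. b \<in> B \<Longrightarrow> v b \<in> univ M"
  shows "satp M (\<lambda>i. g (e i)) (\<lambda>b. g (v b)) \<phi> \<longleftrightarrow> satp M e v \<phi>"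
  using assms(3,4)
proof (induction \<phi> arbitrary: e n)
  case (Equ s t)
  have ev: "evalp M e v t \<in> univ M \<and> evalp M (\<lambda>i. g (e i)) (\<lambda>b. g (v b)) t = g (evalp M e v t)"
    if "t \<in> tms L B n" for t by (rule automorphism_eval[OF assms(1,2) that]) (use Equ assms in auto)
  have "inj_on g (univ M)" using assms(2) by (auto simp: automorphism_def bij_betw_def)
  then show ?case using ev[of s] ev[of t] Equ.prems(1) by (auto dest: inj_onD)
next
  case (Rel R ts)
  let ?xs = "map (evalp M e v) ts"
  have ev: "evalp M e v t \<in> univ M \<and> evalp M (\<lambda>i. g (e i)) (\<lambda>b. g (v b)) t = g (evalp M e v t)"
    if "t \<in> set ts" for t
    by (rule automorphism_eval[OF assms(1,2), of _ B n]) (use that Rel assms in auto)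
  have "?xs \<in> tuples (rarity L R) (univ M)" using ev Rel.prems by (auto simp: tuples_def)
  moreover have "map (evalp M (\<lambda>i. g (e i)) (\<lambda>b. g (v b))) ts = map g ?xs" using ev by auto
  ultimately show ?case using assms(2) Rel.prems
    by (simp add: automorphism_def del: map_map)
next
  case (Exi \<phi>)
  have IH: "satp M (case_nat (g x) (\<lambda>i. g (e i))) (\<lambda>b. g (v b)) \<phi> \<longleftrightarrow> satp M (case_nat x e) v \<phi>"
    if "x \<in> univ M" for x
  proof -
    have "satp M (\<lambda>i. g (case_nat x e i)) (\<lambda>b. g (v b)) \<phi> \<longleftrightarrow> satp M (case_nat x e) v \<phi>"
      by (rule Exi.IH[where n = "Suc n"]) (use Exi.prems that in \<open>auto split: nat.split\<close>)
    moreover have "(\<lambda>i. g (case_nat x e i)) = case_nat (g x) (\<lambda>i. g (e i))"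
      by (rule ext) (simp split: nat.split)
    ultimately show ?thesis by simp
  qed
  have "g ` univ M = univ M" using assms(2) by (auto simp: automorphism_def bij_betw_def)
  then have "(\<exists>y\<in>univ M. Q y) \<longleftrightarrow> (\<exists>x\<in>univ M. Q (g x))" for Q by (metis image_iff)
  from this[of "\<lambda>y. satp M (case_nat y (\<lambda>i. g (e i))) (\<lambda>b. g (v b)) \<phi>"] IH show ?case by auto
next
  case (Conj \<phi> \<psi>)
  then show ?case by (metis fmls_simps(4) satp.simps(4))
next
  case (Neg \<phi>)
  then show ?case by (metis fmls_simps(3) satp.simps(3))
qed

lemma automorphism_holds:
  assumes "is_struct L M" "automorphism L M g" "\<phi> \<in> fmls L B n" "xs \<in> tuples n (univ M)" "B \<subseteq> univ M"
    "\<And>b. b \<in> B \<Longrightarrow> g b = b"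
  shows "holds M (map g xs) \<phi> \<longleftrightarrow> holds M xs \<phi>"
proof -
  have "holds M (map g xs) \<phi> \<longleftrightarrow> satp M (\<lambda>i. g (xs ! i)) (\<lambda>b. g b) \<phi>"
    unfolding holds_satp by (rule satp_cong_fmls[OF assms(3)]) (use assms in \<open>auto simp: tuples_def\<close>)
  also have "\<dots> \<longleftrightarrow> holds M xs \<phi>" unfolding holds_satp
    by (rule automorphism_satp[OF assms(1,2,3)]) (use assms in \<open>auto simp: tuples_def\<close>)
  finally show ?thesis .
qed

lemma automorphism_map_tuples:
  "automorphism L M g \<Longrightarrow> xs \<in> tuples n (univ M) \<Longrightarrow> map g xs \<in> tuples n (univ M)"
  by (auto simp: automorphism_def bij_betw_def tuples_def)

lemma tuples_append: "xs \<in> tuples n B \<Longrightarrow> ys \<in> tuples m B \<Longrightarrow> xs @ ys \<in> tuples (n + m) B"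
  by (auto simp: tuples_def)

section \<open>Realizations and conjugacy in a monster model\<close>

locale monster_model =
  fixes L :: "('f, 'r) lang" and M :: "('f, 'r, 'a) fostruct" and \<kappa> :: "'k rel"
  assumes monster: "monster L M \<kappa>"
begin

abbreviation sm :: "'a set \<Rightarrow> bool" where
  "sm \<equiv> small M \<kappa>"

definition real_over :: "('f, 'r, 'a) ntype \<Rightarrow> 'a set \<Rightarrow> 'a list \<Rightarrow> bool" where
  "real_over P B a \<longleftrightarrow> realizes M (fst P) a (restr (snd P) B)"

definition aut_over :: "'a set \<Rightarrow> ('a \<Rightarrow> 'a) \<Rightarrow> bool" where
  "aut_over B g \<longleftrightarrow> automorphism L M g \<and> (\<forall>b\<in>B. g b = b)"

lemma struct: "is_struct L M"
  using monster by (simp add: monster_def)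

text \<open>The equations \<open>Equ (Var i) (Var i)\<close> are infinitely many formulas without
  parameters, and \<kappa> exceeds the number of such formulas. Hence finite sets are small and
  small sets are closed under union.\<close>

lemma infinite_Field: "\<not> finite (Field \<kappa>)"
proof
  assume fin: "finite (Field \<kappa>)"
  let ?Fm = "{\<phi> :: ('f, 'r, 'a) fm. wf_fm L \<phi> \<and> pars_fm \<phi> = {}}"
  let ?q = "\<lambda>i. Equ (Var i) (Var i) :: ('f, 'r, 'a) fm"
  have "range ?q \<subseteq> ?Fm" by auto
  moreover have "infinite (range ?q)" by (auto simp: finite_image_iff inj_def)
  ultimately have "infinite ?Fm" using infinite_super by blast
  moreover have "(card_of ?Fm, card_of (Field \<kappa>)) \<in> ordLeq"
    using monster ordLess_imp_ordLeq[of "card_of ?Fm" \<kappa>]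
      ordLeq_ordIso_trans[OF _ ordIso_symmetric[OF card_of_Field_ordIso[of \<kappa>]]]
    by (simp add: monster_def)
  ultimately show False using fin card_of_ordLeq_finite by blast
qed

lemma sm_finite: "finite A \<Longrightarrow> A \<subseteq> univ M \<Longrightarrow> sm A"
  using monster infinite_Field finite_ordLess_infinite[of "card_of A" \<kappa>, OF card_of_Well_order]
  by (auto simp: small_def monster_def Field_card_of card_order_on_def)

lemma sm_Un: "sm A \<Longrightarrow> sm B \<Longrightarrow> sm (A \<union> B)"
  using monster infinite_Field card_of_Un_ordLess_infinite_Field[of \<kappa> A B]
  by (auto simp: small_def monster_def)

lemma sm_Un_finite: "sm A \<Longrightarrow> finite F \<Longrightarrow> F \<subseteq> univ M \<Longrightarrow> sm (A \<union> F)"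
  by (rule sm_Un[OF _ sm_finite])

lemma sm_univ: "sm A \<Longrightarrow> A \<subseteq> univ M"
  by (simp add: small_def)

lemma real_over_tuples: "real_over P B a \<Longrightarrow> a \<in> tuples (fst P) (univ M)"
  by (simp add: real_over_def realizes_def)

lemma sm_tuple: "sm B \<Longrightarrow> real_over P C a \<Longrightarrow> sm (B \<union> set a)"
  by (rule sm_Un_finite) (auto simp: tuples_def dest!: real_over_tuples)

lemma real_over_mono: "real_over P B a \<Longrightarrow> C \<subseteq> B \<Longrightarrow> real_over P C a"
  by (auto simp: real_over_def realizes_def restr_def)

lemma real_over_holds:
  assumes "global_type L M P" "real_over P B a" "\<phi> \<in> fmls L B (fst P)" "B \<subseteq> univ M"
  shows "holds M a \<phi> \<longleftrightarrow> \<phi> \<in> snd P"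
proof -
  have p: "snd P \<in> Stp L M (fst P) (univ M)" using assms(1) by (simp add: global_type_def)
  have "\<phi> \<in> fmls L (univ M) (fst P)" using fmls_mono[OF assms(3,4)] by simp
  then have "Neg \<phi> \<in> snd P \<longleftrightarrow> \<phi> \<notin> snd P" using Stp_Neg_iff[OF p] by blast
  moreover have "\<psi> \<in> snd P \<Longrightarrow> pars_fm \<psi> \<subseteq> B \<Longrightarrow> holds M a \<psi>" for \<psi>
    using assms(2) by (auto simp: real_over_def realizes_def restr_def)
  from this[of \<phi>] this[of "Neg \<phi>"] have "\<phi> \<in> snd P \<Longrightarrow> holds M a \<phi>" "Neg \<phi> \<in> snd P \<Longrightarrow> \<not> holds M a \<phi>"
    using assms(3) by (auto simp: fmls_def)
  ultimately show ?thesis by blast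
qed

lemma saturated: "sm B \<Longrightarrow> p \<in> Stp L M n B \<Longrightarrow> \<exists>xs. realizes M n xs p"
  using monster by (auto simp: monster_def)

lemma ex_real_over:
  assumes "global_type L M P" "sm B"
  obtains a where "real_over P B a"
  using saturated[OF assms(2) Stp_restr] assms sm_univ unfolding real_over_def global_type_def by blast

lemma aut_over_mono: "aut_over B g \<Longrightarrow> C \<subseteq> B \<Longrightarrow> aut_over C g"
  by (auto simp: aut_over_def)

lemma aut_over_comp:
  assumes "aut_over B g" "aut_over B h"
  shows "aut_over B (\<lambda>x. h (g x))"
  unfolding aut_over_def automorphism_def
proof (intro conjI ballI)
  have g: "automorphism L M g" and h: "automorphism L M h" using assms by (auto simp: aut_over_def)
  show "bij_betw (\<lambda>x. h (g x)) (univ M) (univ M)"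
    using g h bij_betw_trans[of g _ _ h, unfolded comp_def] by (auto simp: automorphism_def)
  show "h (g (fint M f xs)) = fint M f (map (\<lambda>x. h (g x)) xs)"
    if f: "f \<in> fsyms L" "xs \<in> tuples (farity L f) (univ M)" for f xs
  proof -
    have "g (fint M f xs) = fint M f (map g xs)" using g f by (simp add: automorphism_def)
    moreover have "h (fint M f (map g xs)) = fint M f (map h (map g xs))"
      using h f automorphism_map_tuples[OF g f(2)] by (simp add: automorphism_def del: map_map)
    ultimately show ?thesis by (simp add: comp_def)
  qed
  show "rint M R xs \<longleftrightarrow> rint M R (map (\<lambda>x. h (g x)) xs)"
    if R: "R \<in> rsyms L" "xs \<in> tuples (rarity L R) (univ M)" for R xs
  proof -
    have "rint M R xs \<longleftrightarrow> rint M R (map g xs)" using g R by (simp add: automorphism_def)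
    also have "\<dots> \<longleftrightarrow> rint M R (map h (map g xs))"
      using h R automorphism_map_tuples[OF g R(2)] by (simp add: automorphism_def del: map_map)
    finally show ?thesis by (simp add: comp_def)
  qed
  show "h (g x) = x" if "x \<in> B" for x using assms that by (auto simp: aut_over_def)
qed

lemma aut_over_holds:
  assumes "aut_over B g" "\<phi> \<in> fmls L B n" "xs \<in> tuples n (univ M)" "B \<subseteq> univ M"
  shows "holds M (map g xs) \<phi> \<longleftrightarrow> holds M xs \<phi>"
  by (rule automorphism_holds[OF struct _ assms(2,3,4)]) (use assms(1) in \<open>auto simp: aut_over_def\<close>)

text \<open>Equality of the types makes the map that fixes \<open>B\<close> and sends
  \<open>a\<close> to \<open>a'\<close> partial elementary, and strong homogeneity extends it to an
  automorphism.\<close>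

lemma homogeneous:
  assumes "sm B" "a \<in> tuples n (univ M)" "a' \<in> tuples n (univ M)"
    "\<And>\<phi>. \<phi> \<in> fmls L B n \<Longrightarrow> holds M a \<phi> \<longleftrightarrow> holds M a' \<phi>"
  obtains g where "aut_over B g" "map g a = a'"
proof -
  have len: "length a = n" "length a' = n" and sub: "set a \<subseteq> univ M" "set a' \<subseteq> univ M"
    using assms(2,3) by (auto simp: tuples_def)
  have "\<forall>x\<in>set a. \<exists>j < n. a ! j = x" by (auto simp: in_set_conv_nth len)
  then obtain k where k: "\<And>x. x \<in> set a \<Longrightarrow> k x < n \<and> a ! k x = x" by metis
  define h where "h x = (if x \<in> B then x else a' ! k x)" for x
  define \<pi> :: "'a \<Rightarrow> ('f, 'a) tm" where "\<pi> x = (if x \<in> B then Par x else Var (k x))" for x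
  have "partial_elem L M (B \<union> set a) h" unfolding partial_elem_def
  proof (intro conjI ballI)
    show "B \<union> set a \<subseteq> univ M" using sm_univ[OF assms(1)] sub by auto
    show "h ` (B \<union> set a) \<subseteq> univ M"
      using sm_univ[OF assms(1)] sub k len by (auto simp: h_def)
    fix \<phi> :: "('f, 'r, 'a) fm" assume \<phi>: "\<phi> \<in> fmls L (B \<union> set a) 0"
    have "holds M [] \<phi> \<longleftrightarrow> holds M a (psub_fm Var \<pi> \<phi>)" unfolding holds_satp satp_psub
      by (rule satp_cong_fmls[OF \<phi>]) (use k in \<open>auto simp: \<pi>_def\<close>)
    also have "\<dots> \<longleftrightarrow> holds M a' (psub_fm Var \<pi> \<phi>)"
      by (rule assms(4), rule psub_fmls[OF \<phi>]) (use k in \<open>auto simp: \<pi>_def\<close>)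
    also have "\<dots> \<longleftrightarrow> holds M [] (map_fm h \<phi>)" unfolding holds_satp satp_psub satp_map_fm
      by (rule satp_cong_fmls[OF \<phi>]) (use k in \<open>auto simp: \<pi>_def h_def\<close>)
    finally show "holds M [] \<phi> \<longleftrightarrow> holds M [] (map_fm h \<phi>)" .
  qed
  moreover have "sm (B \<union> set a)" using assms(1) sub by (intro sm_Un_finite) auto
  ultimately obtain g where g: "automorphism L M g" "\<forall>x\<in>B \<union> set a. g x = h x"
    using monster unfolding monster_def by blast
  have "map g a = a'"
  proof (rule nth_equalityI)
    fix i assume "i < length (map g a)"
    then have i: "i < n" using len by simp
    \<comment> \<open>Entries may repeat or lie in \<open>B\<close>. Equality of an entry with a
      parameter, or with its chosen occurrence, belongs to the common type, so \<open>h\<close> has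
      the right value in both cases.\<close>
    have "h (a ! i) = a' ! i"
    proof (cases "a ! i \<in> B")
      case True
      then show ?thesis using assms(4)[of "Equ (Var i) (Par (a ! i))"] i by (auto simp: h_def holds_def)
    next
      case False
      then show ?thesis using assms(4)[of "Equ (Var i) (Var (k (a ! i)))"] i k[of "a ! i"] len
        by (auto simp: h_def holds_def)
    qed
    then show "map g a ! i = a' ! i" using g i len by simp
  qed (simp add: len)
  moreover have "aut_over B g" using g by (auto simp: aut_over_def h_def)
  ultimately show thesis using that by blast
qed

lemma real_over_homogeneous:
  assumes "global_type L M P" "sm B" "real_over P B a" "real_over P B a'"
  obtains g where "aut_over B g" "map g a = a'"
  using homogeneous[OF assms(2) real_over_tuples[OF assms(3)] real_over_tuples[OF assms(4)]]
    real_over_holds[OF assms(1,3)] real_over_holds[OF assms(1,4)] sm_univ[OF assms(2)] by metis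

lemma nonsplitting:
  assumes "invariant_over L M A P" "\<phi> \<in> fmls L {} (fst P + k)" "as \<in> tuples k (univ M)"
    "bs \<in> tuples k (univ M)" "tp L M as A = tp L M bs A" "inst (fst P) \<phi> as \<in> snd P"
  shows "inst (fst P) \<phi> bs \<in> snd P"
  using assms unfolding invariant_over_def splits_def by blast

text \<open>Nonsplitting over \<open>A\<close> in the form used below: an automorphism fixing
  \<open>A\<close> carries realizations of the restriction to \<open>B\<close> to realizations of
  the restriction to the image of \<open>B\<close>.\<close>

lemma real_over_aut:
  assumes P: "invariant_over L M A P" and "A \<subseteq> univ M" and g: "aut_over A g"
    and "real_over P B a" "B \<subseteq> univ M"
  shows "real_over P (g ` B) (map g a)"
proof -
  have p: "snd P \<in> Stp L M (fst P) (univ M)" using P by (simp add: invariant_over_def global_type_def)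
  have autg: "automorphism L M g" using g by (simp add: aut_over_def)
  have a: "a \<in> tuples (fst P) (univ M)" using assms(4) by (rule real_over_tuples)
  have "holds M (map g a) \<phi>" if \<phi>P: "\<phi> \<in> snd P" and pars: "pars_fm \<phi> \<subseteq> g ` B" for \<phi>
  proof -
    \<comment> \<open>The parameters of \<open>\<phi>\<close> are pulled back along \<open>g\<close>
      to a tuple from \<open>B\<close>, so that nonsplitting can compare the two tuples.\<close>
    obtain ds' where ds': "set ds' \<subseteq> B" "set (map g ds') = pars_fm \<phi>"
    proof (atomize_elim)
      from finite_subset_image[OF finite_pars_fm pars]
      obtain C where C: "C \<subseteq> B \<and> finite C \<and> pars_fm \<phi> = g ` C" ..
      then obtain cs where "set cs = C" using finite_list[of C] by auto
      then show "\<exists>ds'. set ds' \<subseteq> B \<and> set (map g ds') = pars_fm \<phi>" using C by auto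
    qed
    define ds where "ds = map g ds'"
    define k where "k = length ds"
    have \<phi>: "\<phi> \<in> fmls L ({} \<union> set ds) (fst P)"
      using \<phi>P p ds'(2) by (auto simp: Stp_def fmls_def ds_def)
    obtain \<phi>' where \<phi>': "\<phi>' \<in> fmls L {} (fst P + k)" and eq:
      "\<forall>e v. satp M e v \<phi> \<longleftrightarrow>
       satp M (\<lambda>i. if i < fst P then e i else v (ds ! (i - fst P))) v \<phi>'"
      using abstract_parameters[OF \<phi>, of M] unfolding k_def .
    have dsk': "ds' \<in> tuples k (univ M)" using ds' assms(5) by (auto simp: k_def ds_def tuples_def)
    then have dsk: "ds \<in> tuples k (univ M)" using autg automorphism_map_tuples by (auto simp: ds_def)
    have "inst (fst P) \<phi>' ds \<in> snd P"
    proof (rule Stp_equiv[OF p \<phi>P])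
      show "inst (fst P) \<phi>' ds \<in> fmls L (univ M) (fst P)" by (rule inst_fmls[OF \<phi>' dsk]) simp
      show "holds M xs (inst (fst P) \<phi>' ds)" if "holds M xs \<phi>" for xs
        using that unfolding holds_satp satp_inst eq[rule_format] .
    qed
    \<comment> \<open>As \<open>g\<close> fixes \<open>A\<close> pointwise, the two tuples have the
      same type over \<open>A\<close>. Nonsplitting moves the formula to \<open>ds'\<close>, where
      the hypothesis on \<open>a\<close> applies.\<close>
    moreover have "tp L M ds' A = tp L M ds A"
      using aut_over_holds[OF g _ dsk' assms(2)] dsk' dsk by (auto simp: tp_def ds_def tuples_def)
    ultimately have "inst (fst P) \<phi>' ds' \<in> snd P" using nonsplitting[OF P \<phi>' dsk dsk'] by simp
    moreover have "inst (fst P) \<phi>' ds' \<in> fmls L B (fst P)"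
      using \<phi>' ds' by (intro inst_fmls[where B = "{}" and k = k]) (auto simp: tuples_def k_def ds_def)
    ultimately have "holds M a (inst (fst P) \<phi>' ds')"
      using real_over_holds[OF _ assms(4)] P assms(5) by (auto simp: invariant_over_def)
    then have "holds M (a @ ds') \<phi>'" using holds_inst[OF \<phi>'] a by (auto simp: tuples_def)
    then have "holds M (map g (a @ ds')) \<phi>'"
      using automorphism_holds[OF struct autg \<phi>' tuples_append[OF a dsk']] by simp
    then have "holds M (map g a) (inst (fst P) \<phi>' ds)"
      using holds_inst[OF \<phi>', of "map g a"] a by (auto simp: tuples_def ds_def)
    then show ?thesis unfolding holds_satp satp_inst eq[rule_format] .
  qed
  then show ?thesis using automorphism_map_tuples[OF autg a]
    by (auto simp: real_over_def realizes_def restr_def)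
qed

lemma real_over_aut_Un:
  assumes "invariant_over L M A P" "A \<subseteq> B" "aut_over B g" "real_over P (B \<union> set b) a"
    "B \<union> set b \<subseteq> univ M"
  shows "real_over P (B \<union> set (map g b)) (map g a)"
proof -
  have "g ` (B \<union> set b) = B \<union> set (map g b)" using assms(3) by (force simp: aut_over_def)
  then show ?thesis using real_over_aut[OF assms(1) _ aut_over_mono[OF assms(3,2)] assms(4,5)] assms(2,5)
    by (metis le_supE order_trans)
qed

lemma invariant_over_global: "invariant_over L M A P \<Longrightarrow> global_type L M P"
  by (simp add: invariant_over_def)

text \<open>One automorphism takes \<open>b\<close> to \<open>b'\<close>; by invariance of
  \<open>P\<close> the image of \<open>a\<close> still realizes \<open>P\<close> over
  \<open>A\<close> and \<open>b'\<close>, so a second automorphism over this set takes it to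
  \<open>a'\<close>.\<close>

lemma pair_homogeneous:
  assumes "sm A" "global_type L M Q" "invariant_over L M A0 P" "A0 \<subseteq> A"
    "real_over Q A b" "real_over P (A \<union> set b) a" "real_over Q A b'" "real_over P (A \<union> set b') a'"
  obtains g where "aut_over A g" "map g b = b'" "map g a = a'"
proof -
  obtain g where g: "aut_over A g" "map g b = b'"
    using real_over_homogeneous[OF assms(2,1,5,7)] .
  have "real_over P (A \<union> set b') (map g a)"
    using real_over_aut_Un[OF assms(3,4) g(1) assms(6)] g(2) sm_univ[OF sm_tuple[OF assms(1,5)]] by simp
  then obtain h where h: "aut_over (A \<union> set b') h" "map h (map g a) = a'"
    using real_over_homogeneous[OF invariant_over_global[OF assms(3)] sm_tuple[OF assms(1,7)] _ assms(8)] by metis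
  have "aut_over A (\<lambda>x. h (g x))"
    using aut_over_comp[OF g(1) aut_over_mono[OF h(1)]] by simp
  moreover have "map (\<lambda>x. h (g x)) b = map h b'" using g(2) by (auto simp: comp_def)
  moreover have "map h b' = b'" using h(1) by (auto simp: aut_over_def intro: map_idI)
  moreover have "map (\<lambda>x. h (g x)) a = a'" using h(2) by (simp add: comp_def)
  ultimately show thesis using that by metis
qed

end

section \<open>Symmetry and orthogonality inside the monster model\<close>

text \<open>Instantiation with \<open>inst\<close> keeps the first variables and fills in the later
  ones, whereas in the product the realization chosen last comes last. The formula is therefore
  rewritten with the arguments \<open>y\<close>, \<open>x\<close>, and then its former
  parameters.\<close>

lemma satp_swap_blocks:
  assumes "\<phi> \<in> fmls L (set ms) (n + n)" "\<And>x. x \<in> set ms \<Longrightarrow> idx x < length ms \<and> ms ! idx x = x"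
    "length x = n" "length y = n"
  shows "satp K (\<lambda>i. if i < n then y ! i else (x @ map v ms) ! (i - n)) w
      (psub_fm (\<lambda>i. Var (if i < n then n + i else i - n)) (\<lambda>x. Var (n + n + idx x)) \<phi>) \<longleftrightarrow>
    satp K ((!) (x @ y)) v \<phi>"
  unfolding satp_psub
  by (rule satp_cong_fmls[OF assms(1)]) (use assms(2-) in \<open>auto simp: nth_append\<close>)

section \<open>The product of a type with itself, computed in the monster model\<close>

context monster_model
begin

text \<open>Since a formula has finitely many parameters, a pair realizing \<open>P\<close>
  successively over these and a small base can be found in \<open>M\<close> itself. This replaces
  the elementary extension in \<open>tensor\<close>.\<close>

definition tensor_in :: "'a set \<Rightarrow> ('f, 'r, 'a) ntype \<Rightarrow> ('f, 'r, 'a) fm set" where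
  "tensor_in A P = {\<phi> \<in> fmls L (univ M) (fst P + fst P).
    \<exists>a b. real_over P (A \<union> pars_fm \<phi>) a \<and> real_over P (A \<union> pars_fm \<phi> \<union> set a) b \<and> holds M (a @ b) \<phi>}"

lemma sm_pars: "sm A \<Longrightarrow> \<phi> \<in> fmls L (univ M) n \<Longrightarrow> sm (A \<union> pars_fm \<phi>)"
  by (intro sm_Un_finite finite_pars_fm) (auto simp: fmls_def)

text \<open>All such pairs are conjugate over the base and the parameters by
  \<open>pair_homogeneous\<close>, so a single pair decides membership, also one taken over a larger
  \<open>B\<close>.\<close>

lemma tensor_in_iff:
  assumes "sm A" "invariant_over L M A P" "\<phi> \<in> fmls L (univ M) (fst P + fst P)"
    "A \<union> pars_fm \<phi> \<subseteq> B" "real_over P B a" "real_over P (B \<union> set a) b"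
  shows "\<phi> \<in> tensor_in A P \<longleftrightarrow> holds M (a @ b) \<phi>"
proof -
  let ?C = "A \<union> pars_fm \<phi>"
  have C: "sm ?C" using sm_pars assms(1,3) by blast
  have ab: "real_over P ?C a" "real_over P (?C \<union> set a) b"
    using assms by (blast intro: real_over_mono)+
  have "holds M (a @ b) \<phi> \<longleftrightarrow> holds M (a' @ b') \<phi>"
    if ab': "real_over P ?C a'" "real_over P (?C \<union> set a') b'" for a' b'
  proof -
    obtain g where g: "aut_over ?C g" "map g a = a'" "map g b = b'"
      using pair_homogeneous[OF C invariant_over_global[OF assms(2)] assms(2) _ ab ab'] by auto
    have "holds M (map g (a @ b)) \<phi> \<longleftrightarrow> holds M (a @ b) \<phi>"
      by (rule aut_over_holds[OF g(1)])
        (use assms(3) sm_univ[OF C] tuples_append[OF real_over_tuples[OF ab(1)] real_over_tuples[OF ab(2)]]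
          in \<open>auto simp: fmls_def\<close>)
    then show ?thesis using g by simp
  qed
  then have "(\<exists>a b. real_over P ?C a \<and> real_over P (?C \<union> set a) b \<and> holds M (a @ b) \<phi>) \<longleftrightarrow>
    holds M (a @ b) \<phi>"
    using ab by metis
  then show ?thesis using assms(3) by (simp add: tensor_in_def)
qed

lemma ex_pair:
  assumes "global_type L M P" "global_type L M Q" "sm B"
  obtains a b where "real_over P B a" "real_over Q (B \<union> set a) b"
  using ex_real_over assms sm_tuple by metis

text \<open>One pair chosen over the parameters of a whole finite subset satisfies all its formulas;
  testing \<open>\<phi>\<close> and its negation on the same pair gives completeness.\<close>

lemma tensor_in_Stp:
  assumes "sm A" "invariant_over L M A P"
  shows "tensor_in A P \<in> Stp L M (fst P + fst P) (univ M)"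
proof -
  have P: "global_type L M P" using assms(2) by (rule invariant_over_global)
  have "\<exists>xs. realizes M (fst P + fst P) xs F" if F: "finite F" "F \<subseteq> tensor_in A P" for F
  proof -
    have "sm (A \<union> \<Union>(pars_fm ` F))"
      using F by (intro sm_Un_finite assms(1)) (auto simp: finite_pars_fm tensor_in_def fmls_def)
    then obtain a b where ab: "real_over P (A \<union> \<Union>(pars_fm ` F)) a"
      "real_over P (A \<union> \<Union>(pars_fm ` F) \<union> set a) b" using ex_pair[OF P P] by blast
    have "holds M (a @ b) \<phi>" if "\<phi> \<in> F" for \<phi>
    proof -
      have "\<phi> \<in> tensor_in A P" using F(2) that by blast
      moreover from this have "\<phi> \<in> fmls L (univ M) (fst P + fst P)" by (simp add: tensor_in_def)
      moreover have "A \<union> pars_fm \<phi> \<subseteq> A \<union> \<Union>(pars_fm ` F)" using that by blast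
      ultimately show ?thesis using tensor_in_iff[OF assms _ _ ab] by blast
    qed
    then show ?thesis using tuples_append[OF real_over_tuples[OF ab(1)] real_over_tuples[OF ab(2)]]
      by (auto simp: realizes_def)
  qed
  moreover have "\<phi> \<in> tensor_in A P \<or> Neg \<phi> \<in> tensor_in A P" if \<phi>: "\<phi> \<in> fmls L (univ M) (fst P + fst P)" for \<phi>
  proof -
    obtain a b where ab: "real_over P (A \<union> pars_fm \<phi>) a"
      "real_over P (A \<union> pars_fm \<phi> \<union> set a) b" using ex_pair[OF P P sm_pars[OF assms(1) \<phi>]] .
    then show ?thesis
      using tensor_in_iff[OF assms _ _ ab, of \<phi>] tensor_in_iff[OF assms _ _ ab, of "Neg \<phi>"] \<phi> by auto
  qed
  ultimately show ?thesis by (auto simp: Stp_def tensor_in_def)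
qed

text \<open>The terms \<open>t j\<close> select, uniformly in \<open>M\<close> and in the extension \<open>N\<close>, a tuple from the
  realization of \<open>P\<close> and the elements of \<open>B\<close>.\<close>

lemma selected_type_transfer:
  assumes P: "global_type L M P" and B: "B \<subseteq> univ M"
    and a: "realizes N (fst P) a (map_fm h ` snd P)" and a0: "real_over P B a0"
    and t: "\<And>j. j < k \<Longrightarrow> t j \<in> tms L B (fst P)"
    and d: "length d = k" "\<And>j. j < k \<Longrightarrow> d ! j = evalp N ((!) a) h (t j)"
    and d0: "length d0 = k" "\<And>j. j < k \<Longrightarrow> d0 ! j = evalp M ((!) a0) (\<lambda>b. b) (t j)"
    and \<psi>: "\<psi> \<in> fmls L B k"
  shows "holds N d (map_fm h \<psi>) \<longleftrightarrow> holds M d0 \<psi>"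
proof -
  have p: "snd P \<in> Stp L M (fst P) (univ M)" using P by (simp add: global_type_def)
  define \<psi>' where "\<psi>' = psub_fm t Par \<psi>"
  have \<psi>': "\<psi>' \<in> fmls L B (fst P)" unfolding \<psi>'_def by (rule psub_fmls[OF \<psi>]) (use t in auto)
  then have \<psi>'M: "\<psi>' \<in> fmls L (univ M) (fst P)" using fmls_mono B by blast
  have in_P: "\<chi> \<in> snd P \<Longrightarrow> holds N a (map_fm h \<chi>)" for \<chi> using a by (auto simp: realizes_def)
  have "holds N d (map_fm h \<psi>) \<longleftrightarrow> holds N a (map_fm h \<psi>')"
    unfolding holds_satp satp_map_fm \<psi>'_def satp_psub
    by (rule satp_cong_fmls[OF \<psi>]) (use d in auto)
  also have "\<dots> \<longleftrightarrow> \<psi>' \<in> snd P"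
    using in_P[of \<psi>'] in_P[of "Neg \<psi>'"] Stp_Neg_iff[OF p \<psi>'M] by auto
  also have "\<dots> \<longleftrightarrow> holds M a0 \<psi>'" using real_over_holds[OF P a0 \<psi>' B] by simp
  also have "\<dots> \<longleftrightarrow> holds M d0 \<psi>"
    unfolding holds_satp \<psi>'_def satp_psub by (rule satp_cong_fmls[OF \<psi>]) (use d0 in auto)
  finally show ?thesis .
qed

text \<open>If \<open>\<phi>\<close> failed at the test pair \<open>a0\<close>, \<open>b0\<close> in
  \<open>M\<close>, its negation, as a formula in \<open>y\<close> with parameters \<open>a0\<close>
  and \<open>ms\<close>, would lie in \<open>P\<close>. The corresponding tuple in \<open>N\<close>
  has the matching type over \<open>A\<close>, so the negation would belong to
  \<open>ext_restr\<close> and hold at \<open>b\<close>.\<close>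

lemma tensor_subset_tensor_in:
  assumes A0: "sm A0" "invariant_over L M A0 P"
  shows "tensor L M \<kappa> P P \<subseteq> tensor_in A0 P"
proof
  fix \<phi> assume "\<phi> \<in> tensor L M \<kappa> P P"
  then obtain N :: "('f, 'r, 'a list \<Rightarrow> 'a) fostruct" and h a b A where
    \<phi>: "\<phi> \<in> fmls L (univ M) (fst P + fst P)" and A: "sm A" "invariant_over L M A P"
    and a: "realizes N (fst P) a (map_fm h ` snd P)"
    and b: "realizes N (fst P) b (ext_restr L M A N h P (h ` univ M \<union> set a))"
    and ab: "holds N (a @ b) (map_fm h \<phi>)"
    unfolding tensor_def mem_Collect_eq by (elim conjE exE)
  define n where "n = fst P"
  have P: "global_type L M P" using A(2) by (rule invariant_over_global)
  have p: "snd P \<in> Stp L M n (univ M)" using P by (simp add: global_type_def n_def)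
  have lab: "length a = n" "length b = n" using a b by (auto simp: realizes_def tuples_def n_def)
  \<comment> \<open>The base \<open>A\<close> comes from the definition of \<open>tensor\<close> and
    may differ from \<open>A0\<close>; the test pair is taken over both.\<close>
  let ?C = "A \<union> A0 \<union> pars_fm \<phi>"
  have C: "sm ?C" using sm_pars[OF sm_Un[OF A(1) A0(1)] \<phi>] .
  obtain a0 b0 where ab0: "real_over P ?C a0" "real_over P (?C \<union> set a0) b0"
    using ex_pair[OF P P C] .
  have lab0: "length a0 = n" "length b0 = n" "set a0 \<subseteq> univ M"
    using ab0[THEN real_over_tuples] by (auto simp: tuples_def n_def)
  obtain ms where ms: "set ms = pars_fm \<phi>" using finite_list[OF finite_pars_fm[of \<phi>]] ..
  have "\<forall>x\<in>set ms. \<exists>j < length ms. ms ! j = x" by (auto simp: in_set_conv_nth)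
  then obtain idx where idx: "\<And>x. x \<in> set ms \<Longrightarrow> idx x < length ms \<and> ms ! idx x = x" by metis
  define k where "k = n + length ms"
  define \<phi>1 :: "('f, 'r, 'a) fm" where
    "\<phi>1 = psub_fm (\<lambda>i. Var (if i < n then n + i else i - n)) (\<lambda>x. Var (n + n + idx x)) \<phi>"
  have \<phi>': "\<phi> \<in> fmls L (set ms) (n + n)" using fmls_pars[OF \<phi>] by (simp add: ms n_def)
  have \<phi>1: "\<phi>1 \<in> fmls L {} (n + k)"
    unfolding \<phi>1_def by (rule psub_fmls[OF \<phi>']) (use idx in \<open>auto simp: k_def\<close>)
  have semM: "satp M (\<lambda>i. if i < n then y ! i else (x @ ms) ! (i - n)) (\<lambda>b. b) \<phi>1 \<longleftrightarrow>
    holds M (x @ y) \<phi>" if "length x = n" "length y = n" for x y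
    using satp_swap_blocks[OF \<phi>' idx that, of M "\<lambda>b. b" "\<lambda>b. b"] by (simp add: holds_satp \<phi>1_def cong: if_cong)
  define d where "d = a @ map h ms"
  define d' where "d' = a0 @ ms"
  define t :: "nat \<Rightarrow> ('f, 'a) tm" where "t j = (if j < n then Var j else Par (ms ! (j - n)))" for j
  have msM: "set ms \<subseteq> univ M" using \<phi> ms by (auto simp: fmls_def)
  have d'k: "d' \<in> tuples k (univ M)" using lab0 msM by (auto simp: d'_def tuples_def k_def)
  have dk: "d \<in> tuples k (h ` univ M \<union> set a)" using lab msM by (auto simp: d_def tuples_def k_def)
  have tr: "holds N d (map_fm h \<psi>) \<longleftrightarrow> holds M d' \<psi>" if \<psi>: "\<psi> \<in> fmls L A k" for \<psi>
  proof (rule selected_type_transfer[OF P sm_univ[OF C] a ab0(1), where t = t and k = k])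
    show "t j \<in> tms L ?C (fst P)" if "j < k" for j
      using that ms by (auto simp: t_def n_def k_def)
    show "d ! j = evalp N ((!) a) h (t j)" if "j < k" for j
      using that lab by (auto simp: d_def t_def nth_append k_def)
    show "d' ! j = evalp M ((!) a0) (\<lambda>b. b) (t j)" if "j < k" for j
      using that lab0 by (auto simp: d'_def t_def nth_append k_def)
    show "\<psi> \<in> fmls L ?C k" by (rule fmls_mono[OF \<psi>]) auto
  qed (use dk d'k in \<open>auto simp: tuples_def\<close>)
  have "holds M (a0 @ b0) \<phi>"
  proof (rule ccontr)
    assume neg: "\<not> holds M (a0 @ b0) \<phi>"
    have inst1: "inst n (Neg \<phi>1) d' \<in> fmls L (?C \<union> set a0) n"
      by (rule inst_fmls[where B = "{}" and k = k]) (use \<phi>1 d'k ms in \<open>auto simp: d'_def tuples_def\<close>)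
    have "holds M b0 (inst n (Neg \<phi>1) d')"
      using semM[OF lab0(1,2)] neg by (simp add: holds_satp satp_inst d'_def)
    then have "inst n (Neg \<phi>1) d' \<in> snd P"
      using real_over_holds[OF P ab0(2)] inst1 sm_univ[OF sm_tuple[OF C ab0(1)]] by (simp add: n_def)
    moreover have "tp L N d (h ` A) = map_fm h ` tp L M d' A"
    proof
      show "map_fm h ` tp L M d' A \<subseteq> tp L N d (h ` A)"
        using tr dk d'k by (auto simp: tp_def tuples_def intro: map_fm_fmls)
      show "tp L N d (h ` A) \<subseteq> map_fm h ` tp L M d' A"
      proof
        fix \<chi> assume \<chi>: "\<chi> \<in> tp L N d (h ` A)"
        then have \<chi>k: "\<chi> \<in> fmls L (h ` A) k" using dk by (auto simp: tp_def tuples_def)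
        \<comment> \<open>On the image of \<open>A\<close> the map \<open>inv_into A h\<close> is a
          right inverse of \<open>h\<close>, so \<open>\<psi>\<close> is a formula over
          \<open>A\<close> whose translation is \<open>\<chi>\<close>.\<close>
        define \<psi> where "\<psi> = map_fm (inv_into A h) \<chi>"
        have \<psi>: "\<psi> \<in> fmls L A k" unfolding \<psi>_def
          by (rule map_fm_fmls[OF \<chi>k]) (auto intro: inv_into_into)
        have "map_fm h \<psi> = map_fm (\<lambda>x. x) \<chi>" unfolding \<psi>_def fm.map_comp comp_def
          by (rule fm.map_cong0) (use \<chi>k in \<open>auto simp: fmls_def f_inv_into_f dest!: subsetD\<close>)
        then have "map_fm h \<psi> = \<chi>" by (simp add: fm.map_ident)
        moreover have "\<psi> \<in> tp L M d' A"
          using \<psi> tr[OF \<psi>] \<chi> calculation d'k by (auto simp: tp_def tuples_def)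
        ultimately show "\<chi> \<in> map_fm h ` tp L M d' A" by blast
      qed
    qed
    ultimately have "inst n (map_fm h (Neg \<phi>1)) d \<in> ext_restr L M A N h P (h ` univ M \<union> set a)"
      unfolding ext_restr_def using \<phi>1 dk d'k unfolding n_def by fastforce
    then have "holds N b (inst n (map_fm h (Neg \<phi>1)) d)" using b by (auto simp: realizes_def)
    then have "\<not> satp N (\<lambda>i. if i < n then b ! i else d ! (i - n)) h \<phi>1"
      by (simp add: holds_satp satp_inst satp_map_fm)
    then have "\<not> satp N ((!) (a @ b)) h \<phi>" 
      using satp_swap_blocks[OF \<phi>' idx lab, of N h h] by (simp add: d_def \<phi>1_def cong: if_cong)
    then show False using ab by (simp add: holds_satp satp_map_fm)
  qed
  then show "\<phi> \<in> tensor_in A0 P" using tensor_in_iff[OF A0 \<phi> _ ab0] by blast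
qed

text \<open>The complete type \<open>tensor_in A P\<close> is realized in an ultrapower, and the two
  halves of the realization serve as \<open>a\<close> and \<open>b\<close>. The point is that
  \<open>b\<close> realizes \<open>ext_restr\<close>; each of its formulas is turned into one about
  pairs and checked in \<open>M\<close>.\<close>

lemma tensor_in_subset_tensor:
  assumes A: "sm A" "invariant_over L M A P"
  shows "tensor_in A P \<subseteq> tensor L M \<kappa> P P"
proof
  fix \<phi> assume \<phi>: "\<phi> \<in> tensor_in A P"
  define n where "n = fst P"
  have P: "global_type L M P" using A(2) by (rule invariant_over_global)
  have p: "snd P \<in> Stp L M n (univ M)" using P by (simp add: global_type_def n_def)
  have T: "tensor_in A P \<in> Stp L M (n + n) (univ M)" using tensor_in_Stp[OF A] by (simp add: n_def)
  obtain N :: "('f, 'r, 'a list \<Rightarrow> 'a) fostruct" and h c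
    where N: "elem_emb L M N h" "realizes N (n + n) c (map_fm h ` tensor_in A P)"
    using ultrapower_realizes[OF struct T] .
  define a where "a = take n c"
  define b where "b = drop n c"
  have c: "c = a @ b" by (simp add: a_def b_def)
  have ab: "a \<in> tuples n (univ N)" "b \<in> tuples n (univ N)"
    using N(2) by (auto simp: realizes_def tuples_def a_def b_def dest: in_set_takeD in_set_dropD)
  then have lab: "length a = n" "length b = n" by (auto simp: tuples_def)
  have T_holds: "holds N (a @ b) (map_fm h \<chi>)" if "\<chi> \<in> tensor_in A P" for \<chi>
    using N(2) that c by (auto simp: realizes_def)
  have a: "realizes N n a (map_fm h ` snd P)"
  proof -
    have "holds N a (map_fm h \<chi>)" if \<chi>: "\<chi> \<in> snd P" for \<chi>
    proof -
      have \<chi>n: "\<chi> \<in> fmls L (univ M) n" using \<chi> p by (auto simp: Stp_def)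
      then have \<chi>2: "\<chi> \<in> fmls L (univ M) (n + n)" using fmls_mono by (metis le_add1 order_refl)
      obtain a0 b0 where ab0: "real_over P (A \<union> pars_fm \<chi>) a0"
        "real_over P (A \<union> pars_fm \<chi> \<union> set a0) b0" using ex_pair[OF P P sm_pars[OF A(1) \<chi>n]] .
      have "holds M a0 \<chi>" using ab0(1) \<chi> by (auto simp: real_over_def realizes_def restr_def)
      then have "holds M (a0 @ b0) \<chi>"
        using holds_append[OF \<chi>n] real_over_tuples[OF ab0(1)] by (auto simp: tuples_def n_def)
      then have "\<chi> \<in> tensor_in A P" using tensor_in_iff[OF A _ order_refl ab0] \<chi>2 by (simp add: n_def)
      then show ?thesis using T_holds holds_append[OF map_fm_fmls[OF \<chi>n order_refl] lab(1)] by blast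
    qed
    then show ?thesis using ab by (auto simp: realizes_def)
  qed
  have "holds N b \<chi>" if \<chi>: "\<chi> \<in> ext_restr L M A N h P (h ` univ M \<union> set a)" for \<chi>
  proof -
    obtain k \<phi>1 d d' where \<chi>_eq: "\<chi> = inst n (map_fm h \<phi>1) d" and \<phi>1: "\<phi>1 \<in> fmls L {} (n + k)"
      and d: "d \<in> tuples k (h ` univ M \<union> set a)" and d': "d' \<in> tuples k (univ M)"
      and tp: "tp L N d (h ` A) = map_fm h ` tp L M d' A" and mem: "inst n \<phi>1 d' \<in> snd P"
      using \<chi> unfolding ext_restr_def n_def by blast
    \<comment> \<open>Every entry of \<open>d\<close> is a coordinate of \<open>a\<close> or the
      image of an element of \<open>M\<close>. A term records which, so the same selection can be
      made from \<open>a0\<close> in \<open>M\<close>.\<close>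
    have "\<forall>j<k. \<exists>s. ((\<exists>i<n. s = Var i) \<or> (\<exists>m\<in>univ M. s = Par m)) \<and> d ! j = evalp N ((!) a) h s"
    proof (intro allI impI)
      fix j assume "j < k"
      then have "d ! j \<in> set d" "set d \<subseteq> h ` univ M \<union> set a" using d by (auto simp: tuples_def)
      then have "d ! j \<in> h ` univ M \<union> set a" by blast
      then consider m where "m \<in> univ M" "d ! j = h m" | i where "i < n" "d ! j = a ! i"
        using lab(1) by (auto simp: in_set_conv_nth)
      then show "\<exists>s. ((\<exists>i<n. s = Var i) \<or> (\<exists>m\<in>univ M. s = Par m)) \<and> d ! j = evalp N ((!) a) h s"
      proof cases
        case (1 m)
        then show ?thesis by (intro exI[of _ "Par m"]) auto
      next
        case (2 i)
        then show ?thesis by (intro exI[of _ "Var i"]) auto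
      qed
    qed
    then obtain t where t: "\<And>j. j < k \<Longrightarrow> ((\<exists>i<n. t j = Var i) \<or> (\<exists>m\<in>univ M. t j = Par m)) \<and>
        d ! j = evalp N ((!) a) h (t j)"
      by metis
    have tM: "t j \<in> tms L (univ M) n" if "j < k" for j using t[OF that] by auto
    define B where "B = A \<union> (\<Union>j<k. pars_tm (t j))"
    have B: "sm B" unfolding B_def
      using tM by (intro sm_Un_finite A(1)) (auto simp: finite_pars_tm tms_def)
    have tB: "t j \<in> tms L B n" if "j < k" for j using tM[OF that] that by (auto simp: tms_def B_def)
    \<comment> \<open>\<open>\<phi>1(y, d)\<close> with the entries of \<open>d\<close> replaced by
      their terms in \<open>x\<close>; at the pair \<open>a\<close>, \<open>b\<close> it says the
      same as \<open>\<chi>\<close> at \<open>b\<close>.\<close>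
    define \<chi>1 where "\<chi>1 = psub_fm (\<lambda>i. if i < n then Var (n + i) else t (i - n)) Par \<phi>1"
    have tmono: "s \<in> tms L B n \<Longrightarrow> s \<in> tms L B (n + n)" for s by (fastforce simp: tms_def)
    have \<chi>1B: "\<chi>1 \<in> fmls L B (n + n)"
      unfolding \<chi>1_def by (rule psub_fmls[OF \<phi>1]) (use tB tmono in auto)
    then have \<chi>1: "\<chi>1 \<in> fmls L (univ M) (n + n)" using fmls_mono sm_univ[OF B] by blast
    have pars_\<chi>1: "A \<union> pars_fm \<chi>1 \<subseteq> B" using \<chi>1B by (auto simp: fmls_def B_def)
    obtain a0 b0 where ab0: "real_over P B a0" "real_over P (B \<union> set a0) b0"
      using ex_pair[OF P P B] .
    have lab0: "length a0 = n" "length b0 = n" "set a0 \<subseteq> univ M"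
      using ab0[THEN real_over_tuples] by (auto simp: tuples_def n_def)
    define d0 where "d0 = map (\<lambda>j. evalp M ((!) a0) (\<lambda>b. b) (t j)) [0..<k]"
    have d0B: "d0 \<in> tuples k (B \<union> set a0)"
    proof -
      have "evalp M ((!) a0) (\<lambda>b. b) (t j) \<in> B \<union> set a0" if "j < k" for j
        using t[OF that] tB[OF that] lab0 by auto
      then show ?thesis by (simp add: d0_def tuples_def image_subset_iff)
    qed
    then have d0: "d0 \<in> tuples k (univ M)" using sm_univ[OF sm_tuple[OF B ab0(1)]] by (auto simp: tuples_def)
    have tr: "holds N d (map_fm h \<psi>) \<longleftrightarrow> holds M d0 \<psi>" if \<psi>: "\<psi> \<in> fmls L A k" for \<psi>
    proof (rule selected_type_transfer[OF P sm_univ[OF B] _ ab0(1), where t = t and k = k])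
      show "\<psi> \<in> fmls L B k" by (rule fmls_mono[OF \<psi>]) (auto simp: B_def)
    qed (use a t tB d in \<open>auto simp: n_def tuples_def d0_def\<close>)
    have "holds M d' \<psi> \<Longrightarrow> holds M d0 \<psi>" if \<psi>: "\<psi> \<in> fmls L A k" for \<psi>
    proof -
      assume "holds M d' \<psi>"
      then have "\<psi> \<in> tp L M d' A" using \<psi> d' by (auto simp: tp_def tuples_def)
      then have "map_fm h \<psi> \<in> tp L N d (h ` A)" using tp by blast
      then show ?thesis using tr[OF \<psi>] by (auto simp: tp_def)
    qed
    \<comment> \<open>The implication just proved, applied to a formula and to its negation.\<close>
    then have "holds M d' \<psi> \<longleftrightarrow> holds M d0 \<psi>" if "\<psi> \<in> fmls L A k" for \<psi>
      using that fmls_simps(3)[of \<psi> L A k] holds_Neg by metis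
    then have "tp L M d' A = tp L M d0 A" using d' d0 by (auto simp: tp_def tuples_def)
    \<comment> \<open>The tuple \<open>d0\<close>, selected from \<open>a0\<close> as
      \<open>d\<close> is from \<open>a\<close>, has the type of \<open>d'\<close> over
      \<open>A\<close>, and nonsplitting transfers the formula to it.\<close>
    then have "inst n \<phi>1 d0 \<in> snd P"
      using nonsplitting[OF A(2) _ d' d0] \<phi>1 mem by (simp add: n_def)
    moreover have "inst n \<phi>1 d0 \<in> fmls L (B \<union> set a0) n"
      by (rule inst_fmls[OF \<phi>1 d0B]) simp
    ultimately have "holds M b0 (inst n \<phi>1 d0)"
      using real_over_holds[OF P ab0(2)] sm_univ[OF sm_tuple[OF B ab0(1)]] by (simp add: n_def)
    moreover have "holds M (a0 @ b0) \<chi>1 \<longleftrightarrow> holds M b0 (inst n \<phi>1 d0)"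
      unfolding holds_satp \<chi>1_def satp_psub satp_inst
    proof (rule satp_cong_fmls[OF \<phi>1])
      fix i assume i: "i < n + k"
      have "evalp M ((!) (a0 @ b0)) (\<lambda>a. a) (t j) = evalp M ((!) a0) (\<lambda>a. a) (t j)" if "j < k" for j
        by (rule evalp_cong) (use tB[OF that] lab0 in \<open>auto simp: tms_def nth_append\<close>)
      then show "evalp M ((!) (a0 @ b0)) (\<lambda>a. a) (if i < n then Var (n + i) else t (i - n)) =
        (if i < n then b0 ! i else d0 ! (i - n))"
        using i lab0 by (auto simp: d0_def nth_append)
    qed simp
    ultimately have "\<chi>1 \<in> tensor_in A P"
      using tensor_in_iff[OF A _ pars_\<chi>1 ab0] \<chi>1 by (simp add: n_def)
    then have "holds N (a @ b) (map_fm h \<chi>1)" by (rule T_holds)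
    moreover have "holds N (a @ b) (map_fm h \<chi>1) \<longleftrightarrow> holds N b \<chi>"
      unfolding holds_satp \<chi>1_def satp_psub satp_inst satp_map_fm \<chi>_eq
    proof (rule satp_cong_fmls[OF \<phi>1])
      fix i assume i: "i < n + k"
      have "evalp N ((!) (a @ b)) h (t j) = evalp N ((!) a) h (t j)" if "j < k" for j
        by (rule evalp_cong) (use tB[OF that] lab in \<open>auto simp: tms_def nth_append\<close>)
      then show "evalp N ((!) (a @ b)) h (if i < n then Var (n + i) else t (i - n)) =
        (if i < n then b ! i else d ! (i - n))"
        using i lab t by (auto simp: nth_append)
    qed simp
    ultimately show ?thesis by blast
  qed
  then have b: "realizes N n b (ext_restr L M A N h P (h ` univ M \<union> set a))"
    using ab by (auto simp: realizes_def)
  show "\<phi> \<in> tensor L M \<kappa> P P"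
    unfolding tensor_def mem_Collect_eq
  proof (intro conjI exI)
    show "\<phi> \<in> fmls L (univ M) (fst P + fst P)" using \<phi> by (simp add: tensor_in_def)
    show "holds N (a @ b) (map_fm h \<phi>)" by (rule T_holds[OF \<phi>])
  qed (use N(1) A a b in \<open>simp_all add: n_def\<close>)
qed

lemma tensor_eq: "sm A \<Longrightarrow> invariant_over L M A P \<Longrightarrow> tensor L M \<kappa> P P = tensor_in A P"
  using tensor_subset_tensor_in tensor_in_subset_tensor by blast

text \<open>Exchanging the blocks is an involution on these formulas, so closure under it already
  gives equality of the two products.\<close>

lemma symmetric_iff:
  assumes A: "sm A" "invariant_over L M A P"
  shows "symmetric L M \<kappa> P \<longleftrightarrow>
    (\<forall>\<phi>\<in>tensor_in A P. rename (\<lambda>i. if i < fst P then i + fst P else i - fst P) \<phi> \<in> tensor_in A P)"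
proof -
  let ?s = "\<lambda>i. if i < fst P then i + fst P else i - fst P"
  have "tensor_in A P \<subseteq> rename ?s ` tensor_in A P" if sub: "rename ?s ` tensor_in A P \<subseteq> tensor_in A P"
  proof
    fix \<phi> assume \<phi>: "\<phi> \<in> tensor_in A P"
    have "rename ?s (rename ?s \<phi>) = \<phi>" unfolding rename_rename
      by (rule rename_id[of _ L "univ M" "fst P + fst P"]) (use \<phi> in \<open>auto simp: tensor_in_def\<close>)
    moreover have "rename ?s \<phi> \<in> tensor_in A P" using sub imageI[OF \<phi>] by (rule subsetD)
    ultimately show "\<phi> \<in> rename ?s ` tensor_in A P" using imageI[of "rename ?s \<phi>" _ "rename ?s"] by simp
  qed
  then have "tensor_in A P = rename ?s ` tensor_in A P \<longleftrightarrow> rename ?s ` tensor_in A P \<subseteq> tensor_in A P"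
    by auto
  then show ?thesis by (simp only: symmetric_def tensor_eq[OF A] image_subset_iff)
qed

section \<open>Symmetry and asymmetry read off from pairs of realizations\<close>

lemma holds_swap:
  assumes "\<phi> \<in> fmls L B (n + n)" "length a = n" "length b = n"
  shows "holds M (a @ b) (rename (\<lambda>i. if i < n then i + n else i - n) \<phi>) \<longleftrightarrow> holds M (b @ a) \<phi>"
  unfolding holds_satp satp_rename
  by (rule satp_cong_fmls[OF assms(1)]) (use assms(2,3) in \<open>auto simp: nth_append\<close>)

text \<open>A formula violated by \<open>a\<close> is rewritten with \<open>b\<close> as arguments.
  The resulting \<open>\<theta>\<close> over \<open>A\<close> separates \<open>(a, b)\<close> from
  the pairs whose first entry realizes the type over \<open>A\<close> and \<open>b\<close>, and can
  be moved by automorphisms over \<open>A\<close>.\<close>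

lemma not_real_over_formula:
  assumes "global_type L M P" "a \<in> tuples (fst P) (univ M)" "\<not> real_over P (A \<union> set b) a"
  obtains \<theta> where "\<theta> \<in> fmls L A (fst P + length b)" "\<not> holds M (a @ b) \<theta>"
    "\<forall>c. real_over P (A \<union> set b) c \<longrightarrow> holds M (c @ b) \<theta>"
proof -
  obtain \<psi> where \<psi>: "\<psi> \<in> snd P" "pars_fm \<psi> \<subseteq> A \<union> set b" "\<not> holds M a \<psi>"
    using assms(2,3) by (auto simp: real_over_def realizes_def restr_def)
  have \<psi>f: "\<psi> \<in> fmls L (A \<union> set b) (fst P)"
    using \<psi> assms(1) by (auto simp: global_type_def Stp_def fmls_def)
  obtain \<theta> where \<theta>: "\<theta> \<in> fmls L A (fst P + length b)" and eq:
    "\<forall>e v. satp M e v \<psi> \<longleftrightarrow>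
      satp M (\<lambda>i. if i < fst P then e i else v (b ! (i - fst P))) v \<theta>"
    using abstract_parameters[OF \<psi>f, of M] .
  have h: "holds M (c @ b) \<theta> \<longleftrightarrow> holds M c \<psi>" if "c \<in> tuples (fst P) (univ M)" for c
    unfolding holds_satp eq[rule_format]
    by (rule satp_cong_fmls[OF \<theta>]) (use that in \<open>auto simp: nth_append tuples_def\<close>)
  show thesis
  proof (rule that[OF \<theta>])
    show "\<not> holds M (a @ b) \<theta>" using h[OF assms(2)] \<psi> by simp
    show "\<forall>c. real_over P (A \<union> set b) c \<longrightarrow> holds M (c @ b) \<theta>"
      using h real_over_tuples \<psi> by (auto simp: real_over_def realizes_def restr_def)
  qed
qed

text \<open>Otherwise the negation of the separating formula \<open>\<theta>\<close> lies in the
  product, and by symmetry so does its exchanged form. Tested at \<open>b\<close> and a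
  \<open>c\<close> realizing \<open>P\<close> over \<open>A\<close> and \<open>b\<close>, this
  contradicts the choice of \<open>\<theta>\<close>.\<close>

lemma symmetricD:
  assumes A: "sm A" "invariant_over L M A P" and "symmetric L M \<kappa> P"
    and ab: "real_over P A a" "real_over P (A \<union> set a) b"
  shows "real_over P (A \<union> set b) a"
proof (rule ccontr)
  assume "\<not> real_over P (A \<union> set b) a"
  have P: "global_type L M P" using A(2) by (rule invariant_over_global)
  have at: "a \<in> tuples (fst P) (univ M)" "b \<in> tuples (fst P) (univ M)"
    using ab by (auto intro: real_over_tuples)
  obtain \<theta> where \<theta>: "\<theta> \<in> fmls L A (fst P + length b)" "\<not> holds M (a @ b) \<theta>"
    "\<forall>c. real_over P (A \<union> set b) c \<longrightarrow> holds M (c @ b) \<theta>"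
    using not_real_over_formula[OF P at(1) \<open>\<not> real_over P (A \<union> set b) a\<close>] .
  let ?n = "fst P"
  let ?s = "rename (\<lambda>i. if i < ?n then i + ?n else i - ?n) (Neg \<theta>)"
  have lab: "length a = ?n" "length b = ?n" using at by (auto simp: tuples_def)
  have \<theta>A: "Neg \<theta> \<in> fmls L A (?n + ?n)" using \<theta>(1) lab by simp
  then have \<theta>M: "Neg \<theta> \<in> fmls L (univ M) (?n + ?n)" using fmls_mono sm_univ[OF A(1)] by blast
  have sA: "?s \<in> fmls L A (?n + ?n)" by (rule rename_fmls[OF \<theta>A]) auto
  then have sM: "?s \<in> fmls L (univ M) (?n + ?n)" using fmls_mono sm_univ[OF A(1)] by blast
  have "Neg \<theta> \<in> tensor_in A P"
    using tensor_in_iff[OF A \<theta>M _ ab] \<theta>A \<theta>(2) by (auto simp: fmls_def)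
  then have s: "?s \<in> tensor_in A P" using assms(3) symmetric_iff[OF A] by blast
  have b: "real_over P A b" using real_over_mono[OF ab(2)] by blast
  obtain c where c: "real_over P (A \<union> set b) c" using ex_real_over[OF P sm_tuple[OF A(1) b]] .
  have "holds M (b @ c) ?s" using tensor_in_iff[OF A sM _ b c] s sA by (auto simp: fmls_def)
  moreover have "length c = ?n" using real_over_tuples[OF c] by (simp add: tuples_def)
  ultimately have "holds M (c @ b) (Neg \<theta>)" using holds_swap[OF \<theta>A lab(2)] by blast
  then show False using \<theta>(3) c by simp
qed

text \<open>Asymmetry gives a formula in the product whose exchanged form is not in it. With its
  parameters collected in \<open>F\<close>, it tells the two orders of a pair apart over every
  larger base.\<close>

lemma asymmetricD:
  assumes A: "sm A" "invariant_over L M A P" and "asymmetric L M \<kappa> P"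
  obtains F where "finite F" "F \<subseteq> univ M"
    "\<And>B a b. A \<union> F \<subseteq> B \<Longrightarrow> real_over P B a \<Longrightarrow> real_over P (B \<union> set a) b \<Longrightarrow> \<not> real_over P (B \<union> set b) a"
proof -
  let ?n = "fst P"
  let ?s = "rename (\<lambda>i. if i < ?n then i + ?n else i - ?n)"
  obtain \<phi> where \<phi>: "\<phi> \<in> tensor_in A P" "?s \<phi> \<notin> tensor_in A P"
    using assms(3) symmetric_iff[OF A] by (auto simp: asymmetric_def)
  have \<phi>M: "\<phi> \<in> fmls L (univ M) (?n + ?n)" using \<phi>(1) by (simp add: tensor_in_def)
  have s: "?s \<phi> \<in> fmls L (pars_fm \<phi>) (?n + ?n)" by (rule rename_fmls[OF fmls_pars[OF \<phi>M]]) auto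
  then have sM: "?s \<phi> \<in> fmls L (univ M) (?n + ?n)" using \<phi>M by (auto simp: fmls_def)
  show thesis
  proof (rule that[of "pars_fm \<phi>"])
    show "finite (pars_fm \<phi>)" by (rule finite_pars_fm)
    show "pars_fm \<phi> \<subseteq> univ M" using \<phi>M by (simp add: fmls_def)
    fix B a b assume B: "A \<union> pars_fm \<phi> \<subseteq> B" and ab: "real_over P B a" "real_over P (B \<union> set a) b"
    show "\<not> real_over P (B \<union> set b) a"
    proof
      assume ba: "real_over P (B \<union> set b) a"
      have lab: "length a = ?n" "length b = ?n" using ab[THEN real_over_tuples] by (auto simp: tuples_def)
      have "holds M (a @ b) \<phi>" using tensor_in_iff[OF A \<phi>M B ab] \<phi>(1) by simp
      moreover have "\<not> holds M (b @ a) (?s \<phi>)"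
        using tensor_in_iff[OF A sM _ real_over_mono[OF ab(2)] ba] \<phi>(2) s B by (auto simp: fmls_def)
      ultimately show False using holds_swap[OF \<phi>M lab(2,1)] by simp
    qed
  qed
qed

section \<open>Orthogonality expressed by consistent formulas\<close>

definition consistent_with ::
  "('f, 'r, 'a) ntype \<Rightarrow> ('f, 'r, 'a) ntype \<Rightarrow> ('f, 'r, 'a) fm \<Rightarrow> bool" where
  "consistent_with P Q \<theta> \<longleftrightarrow>
    (\<forall>B. sm B \<longrightarrow> (\<exists>a b. real_over P B a \<and> real_over Q B b \<and> holds M (a @ b) \<theta>))"

lemma holds_rename_append:
  assumes "\<psi> \<in> fmls L C m" "length a = n" "length b = m"
  shows "holds M (a @ b) (rename (\<lambda>i. i + n) \<psi>) \<longleftrightarrow> holds M b \<psi>"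
  unfolding holds_satp satp_rename
  by (rule satp_cong_fmls[OF assms(1)]) (use assms(2,3) in \<open>auto simp: nth_append\<close>)

text \<open>A finite part of the type has finitely many parameters, which form a small set, so the
  hypothesis realizes it; \<open>complete_type_extends\<close> then gives the completion.\<close>

lemma consistent_with_extends:
  assumes P: "global_type L M P" and Q: "global_type L M Q"
    and \<theta>: "\<theta> \<in> fmls L (univ M) (fst P + fst Q)" "consistent_with P Q \<theta>"
  obtains r where "r \<in> Stp L M (fst P + fst Q) (univ M)"
    "snd P \<union> rename (\<lambda>i. i + fst P) ` snd Q \<subseteq> r" "\<theta> \<in> r"
proof -
  let ?n = "fst P" and ?m = "fst Q"
  let ?\<rho> = "\<lambda>i. i + fst P"
  let ?S = "insert \<theta> (snd P \<union> rename ?\<rho> ` snd Q)"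
  have p: "\<phi> \<in> fmls L (univ M) ?n" if "\<phi> \<in> snd P" for \<phi>
    using P that by (auto simp: global_type_def Stp_def)
  have q: "\<phi> \<in> fmls L (univ M) ?m" if "\<phi> \<in> snd Q" for \<phi>
    using Q that by (auto simp: global_type_def Stp_def)
  have "snd P \<subseteq> fmls L (univ M) (?n + ?m)" using p fmls_mono by (metis le_add1 order_refl subsetI)
  moreover have "rename ?\<rho> ` snd Q \<subseteq> fmls L (univ M) (?n + ?m)"
    using q by (auto intro!: rename_fmls)
  ultimately have S: "?S \<subseteq> fmls L (univ M) (?n + ?m)" using \<theta>(1) by simp
  have fin: "\<exists>xs. realizes M (?n + ?m) xs F" if F: "finite F" "F \<subseteq> ?S" for F
  proof -
    let ?B = "\<Union>(pars_fm ` F)"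
    have "F \<subseteq> fmls L (univ M) (?n + ?m)" using F(2) S by (rule order_trans)
    then have "?B \<subseteq> univ M" by (auto simp: fmls_def)
    then have "sm ?B" using F(1) finite_pars_fm by (intro sm_finite) auto
    then obtain a b where ab: "real_over P ?B a" "real_over Q ?B b" "holds M (a @ b) \<theta>"
      using \<theta>(2) by (auto simp: consistent_with_def)
    have lab: "length a = ?n" "length b = ?m"
      using ab(1,2)[THEN real_over_tuples] by (auto simp: tuples_def)
    have "holds M (a @ b) \<phi>" if \<phi>: "\<phi> \<in> F" for \<phi>
    proof -
      consider "\<phi> = \<theta>" | "\<phi> \<in> snd P" | \<psi> where "\<phi> = rename ?\<rho> \<psi>" "\<psi> \<in> snd Q"
        using F(2) \<phi> by blast
      then show ?thesis
      proof cases
        case 1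
        then show ?thesis using ab(3) by simp
      next
        case 2
        then have "holds M a \<phi>" using ab(1) \<phi> by (auto simp: real_over_def realizes_def restr_def)
        then show ?thesis using holds_append[OF p[OF 2] lab(1)] by simp
      next
        case (3 \<psi>)
        have "pars_fm \<psi> \<subseteq> ?B" using \<phi> pars_rename[of ?\<rho> \<psi>] 3(1) by auto
        then have "holds M b \<psi>" using ab(2) 3(2) by (auto simp: real_over_def realizes_def restr_def)
        then show ?thesis using holds_rename_append[OF q[OF 3(2)] lab] 3(1) by simp
      qed
    qed
    then show ?thesis using tuples_append[OF ab(1,2)[THEN real_over_tuples]]
      by (auto simp: realizes_def)
  qed
  obtain r where "r \<in> Stp L M (?n + ?m) (univ M)" "?S \<subseteq> r"
    by (rule complete_type_extends[OF S]) (use fin in auto)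
  then show thesis using that by simp
qed

text \<open>By saturation the restriction of \<open>r\<close> to \<open>B\<close> and the parameters
  of \<theta> is realized, and the realization is cut into two blocks. With the previous lemma,
  \<open>consistent_with\<close> is consistency of \<theta> with
  \<open>P(x) \<union> Q(y)\<close>.\<close>

lemma completion_consistent:
  assumes P: "global_type L M P" and Q: "global_type L M Q"
    and r: "r \<in> Stp L M (fst P + fst Q) (univ M)" "snd P \<union> rename (\<lambda>i. i + fst P) ` snd Q \<subseteq> r"
    and \<theta>: "\<theta> \<in> r"
  shows "consistent_with P Q \<theta>"
  unfolding consistent_with_def
proof (intro allI impI)
  fix B assume B: "sm B"
  let ?n = "fst P" and ?m = "fst Q"
  let ?C = "B \<union> pars_fm \<theta>"
  have "\<theta> \<in> fmls L (univ M) (?n + ?m)" using r(1) \<theta> by (auto simp: Stp_def)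
  then have C: "sm ?C" using sm_pars B by blast
  obtain xs where xs: "realizes M (?n + ?m) xs (restr r ?C)"
    using saturated[OF C Stp_restr[OF r(1) sm_univ[OF C]]] ..
  define a where "a = take ?n xs"
  define b where "b = drop ?n xs"
  have ab: "xs = a @ b" "length a = ?n" "length b = ?m" "a \<in> tuples ?n (univ M)" "b \<in> tuples ?m (univ M)"
    using xs by (auto simp: realizes_def tuples_def a_def b_def dest: in_set_takeD in_set_dropD)
  have h: "holds M (a @ b) \<phi>" if "\<phi> \<in> r" "pars_fm \<phi> \<subseteq> ?C" for \<phi>
    using xs that ab(1) by (auto simp: realizes_def restr_def)
  have "holds M a \<phi>" if "\<phi> \<in> snd P" "pars_fm \<phi> \<subseteq> B" for \<phi>
  proof -
    have "\<phi> \<in> fmls L (univ M) ?n" using P that by (auto simp: global_type_def Stp_def)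
    moreover have "holds M (a @ b) \<phi>" by (rule h) (use r(2) that in auto)
    ultimately show ?thesis using holds_append[of \<phi> L "univ M" ?n a M b] ab(2) by simp
  qed
  then have "real_over P B a" using ab by (auto simp: real_over_def realizes_def restr_def)
  moreover have "holds M b \<phi>" if "\<phi> \<in> snd Q" "pars_fm \<phi> \<subseteq> B" for \<phi>
  proof -
    have "\<phi> \<in> fmls L (univ M) ?m" using Q that by (auto simp: global_type_def Stp_def)
    moreover have "holds M (a @ b) (rename (\<lambda>i. i + ?n) \<phi>)"
      by (rule h) (use r(2) that pars_rename[of _ \<phi>] in auto)
    ultimately show ?thesis using holds_rename_append[of \<phi> "univ M" ?m a ?n b] ab(2,3) by simp
  qed
  then have "real_over Q B b" using ab by (auto simp: real_over_def realizes_def restr_def)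
  moreover have "holds M (a @ b) \<theta>" using h[OF \<theta>] by blast
  ultimately show "\<exists>a b. real_over P B a \<and> real_over Q B b \<and> holds M (a @ b) \<theta>" by blast
qed

text \<open>Two distinct completions disagree on a formula, which is then consistent together with
  its negation; conversely such a formula yields two completions.\<close>

lemma orthogonal_iff:
  assumes P: "global_type L M P" and Q: "global_type L M Q"
  shows "orthogonal L M P Q \<longleftrightarrow>
    (\<forall>\<theta>\<in>fmls L (univ M) (fst P + fst Q). \<not> (consistent_with P Q \<theta> \<and> consistent_with P Q (Neg \<theta>)))"
proof
  assume orth: "orthogonal L M P Q"
  show "\<forall>\<theta>\<in>fmls L (univ M) (fst P + fst Q). \<not> (consistent_with P Q \<theta> \<and> consistent_with P Q (Neg \<theta>))"
  proof (intro ballI notI, elim conjE)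
    fix \<theta> assume \<theta>: "\<theta> \<in> fmls L (univ M) (fst P + fst Q)"
      and c: "consistent_with P Q \<theta>" "consistent_with P Q (Neg \<theta>)"
    obtain r where r: "r \<in> Stp L M (fst P + fst Q) (univ M)"
      "snd P \<union> rename (\<lambda>i. i + fst P) ` snd Q \<subseteq> r" "\<theta> \<in> r"
      using consistent_with_extends[OF P Q \<theta> c(1)] .
    obtain r' where r': "r' \<in> Stp L M (fst P + fst Q) (univ M)"
      "snd P \<union> rename (\<lambda>i. i + fst P) ` snd Q \<subseteq> r'" "Neg \<theta> \<in> r'"
      using consistent_with_extends[OF P Q _ c(2)] \<theta> by auto
    have "r = r'" using orth r(1,2) r'(1,2) unfolding orthogonal_def by (elim ex1E) auto
    then show False using Stp_Neg_iff[OF r(1) \<theta>] r(3) r'(3) by simp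
  qed
next
  assume none: "\<forall>\<theta>\<in>fmls L (univ M) (fst P + fst Q).
    \<not> (consistent_with P Q \<theta> \<and> consistent_with P Q (Neg \<theta>))"
  let ?ext = "\<lambda>r. r \<in> Stp L M (fst P + fst Q) (univ M) \<and>
    snd P \<union> rename (\<lambda>i. i + fst P) ` snd Q \<subseteq> r"
  have sub: "r \<subseteq> r'" if r: "?ext r" and r': "?ext r'" for r r'
  proof
    fix \<theta> assume \<theta>: "\<theta> \<in> r"
    then have \<theta>f: "\<theta> \<in> fmls L (univ M) (fst P + fst Q)" using r by (auto simp: Stp_def)
    show "\<theta> \<in> r'"
    proof (rule ccontr)
      assume "\<theta> \<notin> r'"
      then have "Neg \<theta> \<in> r'" using Stp_Neg_iff[OF conjunct1[OF r'] \<theta>f] by simp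
      then have "consistent_with P Q (Neg \<theta>)" 
        using completion_consistent[OF P Q conjunct1[OF r'] conjunct2[OF r']] by blast
      moreover have "consistent_with P Q \<theta>" 
        using completion_consistent[OF P Q conjunct1[OF r] conjunct2[OF r] \<theta>] .
      ultimately show False using none \<theta>f by simp
    qed
  qed
  obtain u where u: "u \<in> univ M" using struct by (auto simp: is_struct_def)
  \<comment> \<open>A trivially true formula: extending it provides the existence half of unique
    completion.\<close>
  let ?T = "Equ (Par u) (Par u) :: ('f, 'r, 'a) fm"
  have T: "?T \<in> fmls L (univ M) (fst P + fst Q)" using u by simp
  have con: "consistent_with P Q ?T" unfolding consistent_with_def
  proof (intro allI impI)
    fix B assume "sm B"
    then obtain a b where "real_over P B a" "real_over Q B b" using ex_real_over P Q by metis
    then show "\<exists>a b. real_over P B a \<and> real_over Q B b \<and> holds M (a @ b) ?T"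
      by (auto simp: holds_def)
  qed
  obtain r where "r \<in> Stp L M (fst P + fst Q) (univ M)"
    "snd P \<union> rename (\<lambda>i. i + fst P) ` snd Q \<subseteq> r" "?T \<in> r"
    using consistent_with_extends[OF P Q T con] .
  then have r: "?ext r" by blast
  show "orthogonal L M P Q" unfolding orthogonal_def
  proof (rule ex1I[of _ r])
    show "?ext r" by (rule r)
    fix r' assume "?ext r'"
    then show "r' = r" using sub r by blast
  qed
qed

lemma orthogonal_sym:
  assumes P: "global_type L M P" and Q: "global_type L M Q" and orth: "orthogonal L M P Q"
  shows "orthogonal L M Q P"
  unfolding orthogonal_iff[OF Q P]
proof (intro ballI notI, elim conjE)
  fix \<theta> assume \<theta>: "\<theta> \<in> fmls L (univ M) (fst Q + fst P)"
    and c: "consistent_with Q P \<theta>" "consistent_with Q P (Neg \<theta>)"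
  let ?\<rho> = "\<lambda>i. if i < fst Q then i + fst P else i - fst Q"
  have \<theta>': "rename ?\<rho> \<theta> \<in> fmls L (univ M) (fst P + fst Q)" by (rule rename_fmls[OF \<theta>]) auto
  have "holds M (a @ b) (rename ?\<rho> \<theta>) \<longleftrightarrow> holds M (b @ a) \<theta>"
    if "real_over P B a" "real_over Q B b" for a b B
    unfolding holds_satp satp_rename
    by (rule satp_cong_fmls[OF \<theta>])
      (use that[THEN real_over_tuples] in \<open>auto simp: tuples_def nth_append\<close>)
  then have "consistent_with P Q (rename ?\<rho> \<theta>)" "consistent_with P Q (Neg (rename ?\<rho> \<theta>))"
    using c unfolding consistent_with_def holds_Neg by meson+
  then show False using orth \<theta>' orthogonal_iff[OF P Q] by blast
qed

section \<open>Regularity, asymmetry and non-orthogonality over a fixed base\<close>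

definition nonorth_over :: "'a set \<Rightarrow> ('f, 'r, 'a) ntype \<Rightarrow> ('f, 'r, 'a) ntype \<Rightarrow> bool" where
  "nonorth_over A P Q \<longleftrightarrow> (\<forall>B. sm B \<and> A \<subseteq> B \<longrightarrow>
    (\<exists>a b. real_over P B a \<and> real_over Q B b \<and> \<not> real_over P (A \<union> set b) a))"

definition asym_over :: "'a set \<Rightarrow> ('f, 'r, 'a) ntype \<Rightarrow> bool" where
  "asym_over A P \<longleftrightarrow> (\<forall>B a b. A \<subseteq> B \<longrightarrow> real_over P B a \<longrightarrow> real_over P (B \<union> set a) b \<longrightarrow>
    \<not> real_over P (B \<union> set b) a)"

definition reg_over :: "'a set \<Rightarrow> ('f, 'r, 'a) ntype \<Rightarrow> bool" where
  "reg_over A P \<longleftrightarrow> invariant_over L M A P \<and> (\<forall>B a c. sm B \<longrightarrow> A \<subseteq> B \<longrightarrow> real_over P A a \<longrightarrow>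
    \<not> real_over P B a \<longrightarrow> real_over P B c \<longrightarrow> real_over P (B \<union> set a) c)"

text \<open>Equality of types over the larger set implies it over the smaller one. With the
  monotonicity lemmas below, all properties of several types can be placed over one common
  base.\<close>

lemma invariant_over_mono:
  assumes "invariant_over L M A P" "A \<subseteq> B"
  shows "invariant_over L M B P"
proof -
  have "tp L M xs A = {\<phi> \<in> tp L M xs B. pars_fm \<phi> \<subseteq> A}" for xs
    using assms(2) by (auto simp: tp_def fmls_def)
  then have "tp L M xs B = tp L M ys B \<Longrightarrow> tp L M xs A = tp L M ys A" for xs ys by simp
  then have "splits L M B P \<Longrightarrow> splits L M A P" unfolding splits_def by meson
  then show ?thesis using assms(1) by (auto simp: invariant_over_def)
qed

lemma reg_over_mono:
  assumes "reg_over A P" "A \<subseteq> B"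
  shows "reg_over B P"
  unfolding reg_over_def
proof (intro conjI allI impI)
  show "invariant_over L M B P" 
    using assms(1) invariant_over_mono[OF _ assms(2)] by (simp add: reg_over_def)
  fix C a c assume *: "sm C" "B \<subseteq> C" "real_over P B a" "\<not> real_over P C a" "real_over P C c"
  have "real_over P A a" using *(3) assms(2) by (rule real_over_mono)
  then show "real_over P (C \<union> set a) c"
    using * assms order_trans[OF assms(2) *(2)] by (simp add: reg_over_def)
qed

lemma asym_over_mono: "asym_over A P \<Longrightarrow> A \<subseteq> B \<Longrightarrow> asym_over B P"
  unfolding asym_over_def by (meson order_trans)

lemma nonorth_over_mono: "nonorth_over A P Q \<Longrightarrow> A \<subseteq> B \<Longrightarrow> nonorth_over B P Q"
  unfolding nonorth_over_def by (meson Un_mono order_refl order_trans real_over_mono)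

lemma reg_overD:
  "reg_over A P \<Longrightarrow> sm B \<Longrightarrow> A \<subseteq> B \<Longrightarrow> real_over P A a \<Longrightarrow> \<not> real_over P B a \<Longrightarrow> real_over P B c \<Longrightarrow>
    real_over P (B \<union> set a) c"
  by (simp add: reg_over_def)

lemma reg_over_global: "reg_over A P \<Longrightarrow> global_type L M P"
  by (simp add: reg_over_def invariant_over_def)

lemma regularD:
  assumes "regular L M \<kappa> P"
  obtains A where "sm A" "reg_over A P"
proof -
  obtain A where A: "sm A" "regular_over L M \<kappa> A P" using assms by (auto simp: regular_def)
  then have "reg_over A P" unfolding reg_over_def regular_over_def real_over_def by meson
  with A(1) that show thesis by blast
qed

lemma ex_asym_over:
  assumes "sm A" "reg_over A P" "asymmetric L M \<kappa> P"
  obtains B where "sm B" "A \<subseteq> B" "asym_over B P"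
proof -
  have "invariant_over L M A P" using assms(2) by (simp add: reg_over_def)
  then obtain F where F: "finite F" "F \<subseteq> univ M"
    "\<forall>B a b. A \<union> F \<subseteq> B \<longrightarrow> real_over P B a \<longrightarrow> real_over P (B \<union> set a) b \<longrightarrow> \<not> real_over P (B \<union> set b) a"
    using asymmetricD[OF assms(1) _ assms(3)] by metis
  then have "asym_over (A \<union> F) P" by (simp add: asym_over_def)
  then show thesis using that[of "A \<union> F"] sm_Un_finite[OF assms(1) F(1,2)] by blast
qed

text \<open>Non-orthogonality leaves some \<theta> undecided; let \<chi> be whichever of \<theta>
  and its negation fails at a pair \<open>a0\<close>, \<open>b0\<close> with \<open>a0\<close>
  realizing \<open>P\<close> over the base and \<open>b0\<close>. By conjugacy \<chi> fails at all
  such pairs, so the pairs satisfying \<chi>, which exist over every small \<open>B\<close>, are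
  dependent over the base.\<close>

lemma ex_nonorth_over:
  assumes A0: "sm A0" "invariant_over L M A0 P" and Q: "global_type L M Q"
    and "\<not> orthogonal L M P Q"
  obtains A where "sm A" "A0 \<subseteq> A" "nonorth_over A P Q"
proof -
  have P: "global_type L M P" using A0(2) by (rule invariant_over_global)
  obtain \<theta> where \<theta>: "\<theta> \<in> fmls L (univ M) (fst P + fst Q)"
    and c: "consistent_with P Q \<theta>" "consistent_with P Q (Neg \<theta>)"
    using assms(4) orthogonal_iff[OF P Q] by blast
  let ?A = "A0 \<union> pars_fm \<theta>"
  have A: "sm ?A" using sm_pars[OF A0(1) \<theta>] .
  obtain b0 a0 where ab0: "real_over Q ?A b0" "real_over P (?A \<union> set b0) a0"
    using ex_pair[OF Q P A] .
  obtain \<chi> where \<chi>: "\<chi> = \<theta> \<or> \<chi> = Neg \<theta>" "\<not> holds M (a0 @ b0) \<chi>"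
    using that[of \<theta>] that[of "Neg \<theta>"] by auto
  have \<chi>A: "\<chi> \<in> fmls L ?A (fst P + fst Q)" using \<chi>(1) \<theta> by (auto simp: fmls_def)
  have con: "consistent_with P Q \<chi>" using c \<chi>(1) by auto
  have "nonorth_over ?A P Q" unfolding nonorth_over_def
  proof (intro allI impI, elim conjE)
    fix B assume B: "sm B" "?A \<subseteq> B"
    obtain a b where ab: "real_over P B a" "real_over Q B b" "holds M (a @ b) \<chi>"
      using con B(1) by (auto simp: consistent_with_def)
    have "\<not> real_over P (?A \<union> set b) a"
    proof
      assume a: "real_over P (?A \<union> set b) a"
      obtain g where g: "aut_over ?A g" "map g b = b0" "map g a = a0"
        using pair_homogeneous[OF A Q A0(2) _ real_over_mono[OF ab(2) B(2)] a ab0] by blast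
      have "holds M (map g (a @ b)) \<chi> \<longleftrightarrow> holds M (a @ b) \<chi>"
        by (rule aut_over_holds[OF g(1) \<chi>A tuples_append[OF ab(1,2)[THEN real_over_tuples]] sm_univ[OF A]])
      then show False using g \<chi>(2) ab(3) by simp
    qed
    with ab show "\<exists>a b. real_over P B a \<and> real_over Q B b \<and> \<not> real_over P (?A \<union> set b) a" by blast
  qed
  then show thesis using that[of ?A] A by blast
qed

text \<open>Choosing the realization of \<open>P\<close> first or last both yields pairs realizing
  \<open>P(x) \<union> Q(y)\<close> over any small set. A formula separating the two orders would
  thus be undecided by the two types.\<close>

lemma orthogonal_commute:
  assumes A: "sm A" "invariant_over L M A P" "invariant_over L M A Q" and orth: "orthogonal L M P Q"
    and ac: "real_over P A a" "real_over Q (A \<union> set a) c"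
  shows "real_over P (A \<union> set c) a"
proof (rule ccontr)
  assume neg: "\<not> real_over P (A \<union> set c) a"
  have P: "global_type L M P" and Q: "global_type L M Q" using A(2,3) by (auto intro: invariant_over_global)
  have c: "real_over Q A c" using real_over_mono[OF ac(2)] by blast
  obtain \<theta> where \<theta>: "\<theta> \<in> fmls L A (fst P + length c)" "\<not> holds M (a @ c) \<theta>"
    "\<forall>d. real_over P (A \<union> set c) d \<longrightarrow> holds M (d @ c) \<theta>"
    using not_real_over_formula[OF P real_over_tuples[OF ac(1)] neg] .
  have lc: "length c = fst Q" using real_over_tuples[OF c] by (simp add: tuples_def)
  have \<theta>A: "\<theta> \<in> fmls L A (fst P + fst Q)" using \<theta>(1) lc by simp
  then have \<theta>M: "\<theta> \<in> fmls L (univ M) (fst P + fst Q)" using fmls_mono sm_univ[OF A(1)] by blast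
  have aut: "holds M (map g x @ map g y) \<theta> \<longleftrightarrow> holds M (x @ y) \<theta>"
    if "aut_over A g" "x \<in> tuples (fst P) (univ M)" "y \<in> tuples (fst Q) (univ M)" for g x y
    using aut_over_holds[OF that(1) \<theta>A tuples_append[OF that(2,3)] sm_univ[OF A(1)]] by simp
  have "consistent_with P Q \<theta>" unfolding consistent_with_def
  proof (intro allI impI)
    fix B assume "sm B"
    then have AB: "sm (A \<union> B)" using A(1) by (intro sm_Un)
    obtain c' a' where ca: "real_over Q (A \<union> B) c'" "real_over P (A \<union> B \<union> set c') a'"
      using ex_pair[OF Q P AB] .
    have c': "real_over Q A c'" and a': "real_over P (A \<union> set c') a'"
      using ca by (auto elim: real_over_mono)
    obtain g where g: "aut_over A g" "map g c' = c" using real_over_homogeneous[OF Q A(1) c' c] .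
    have "real_over P (A \<union> set c) (map g a')"
      using real_over_aut_Un[OF A(2) order_refl g(1) a'] g(2) sm_univ[OF sm_tuple[OF A(1) c']] by simp
    then have "holds M (map g a' @ map g c') \<theta>" using \<theta>(3) g(2) by simp
    then have "holds M (a' @ c') \<theta>" using aut[OF g(1)] real_over_tuples[OF a'] real_over_tuples[OF c'] by simp
    moreover have "real_over P B a'" "real_over Q B c'" using ca by (auto elim: real_over_mono)
    ultimately show "\<exists>a b. real_over P B a \<and> real_over Q B b \<and> holds M (a @ b) \<theta>" by blast
  qed
  moreover have "consistent_with P Q (Neg \<theta>)" unfolding consistent_with_def
  proof (intro allI impI)
    fix B assume "sm B"
    then have AB: "sm (A \<union> B)" using A(1) by (intro sm_Un)
    \<comment> \<open>Now \<open>P\<close> is realized first, so the pair is conjugate over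
      \<open>A\<close> to \<open>(a, c)\<close>, where \<theta> fails; above it was realized last,
      which made \<theta> true.\<close>
    obtain a' c' where ca: "real_over P (A \<union> B) a'" "real_over Q (A \<union> B \<union> set a') c'"
      using ex_pair[OF P Q AB] .
    have a': "real_over P A a'" and c': "real_over Q (A \<union> set a') c'"
      using ca by (auto elim: real_over_mono)
    obtain g where g: "aut_over A g" "map g a' = a" "map g c' = c"
      using pair_homogeneous[OF A(1) P A(3) order_refl a' c' ac] .
    have "\<not> holds M (a' @ c') \<theta>"
      using aut[OF g(1) real_over_tuples[OF a'] real_over_tuples[OF c']] g(2,3) \<theta>(2) by simp
    moreover have "real_over P B a'" "real_over Q B c'" using ca by (auto elim: real_over_mono)
    ultimately show "\<exists>a b. real_over P B a \<and> real_over Q B b \<and> holds M (a @ b) (Neg \<theta>)" by auto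
  qed
  ultimately show False using orth \<theta>M orthogonal_iff[OF P Q] by blast
qed

section \<open>Asymmetric regular types\<close>

text \<open>This says \<open>c \<in> D(b)\<close>. If not, conjugating \<open>b\<close> to the
  \<open>b'\<close> below keeps \<open>c\<close> outside \<open>D(b')\<close>, while some
  \<open>a > c\<close> lies in \<open>D(b')\<close>; regularity then puts \<open>c\<close> above
  \<open>a\<close>, against asymmetry.\<close>

lemma nonorth_not_real_over:
  assumes A: "sm A" and P: "reg_over A P" "asym_over A P" and Q: "invariant_over L M A Q"
    and no: "nonorth_over A P Q" and c: "real_over P A c" and b: "real_over Q (A \<union> set c) b"
  shows "\<not> real_over P (A \<union> set b) c"
proof
  assume cb: "real_over P (A \<union> set b) c"
  have Ac: "sm (A \<union> set c)" using sm_tuple[OF A c] .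
  have invP: "invariant_over L M A P" using P(1) by (simp add: reg_over_def)
  \<comment> \<open>Non-orthogonality is applied over \<open>A\<close> and \<open>c\<close>, which
    makes \<open>a\<close> lie above \<open>c\<close> and \<open>b'\<close> conjugate to
    \<open>b\<close> with \<open>c\<close> fixed.\<close>
  obtain a b' where ab: "real_over P (A \<union> set c) a" "real_over Q (A \<union> set c) b'"
    "\<not> real_over P (A \<union> set b') a"
    using no Ac unfolding nonorth_over_def by blast
  obtain g where g: "aut_over (A \<union> set c) g" "map g b = b'"
    using real_over_homogeneous[OF invariant_over_global[OF Q] Ac b ab(2)] .
  have "map g c = c" using g(1) by (auto simp: aut_over_def intro: map_idI)
  then have cb': "real_over P (A \<union> set b') c"
    using real_over_aut_Un[OF invP order_refl aut_over_mono[OF g(1)] cb] g(2) sm_univ[OF sm_tuple[OF A b]]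
    by simp
  have "real_over P A a" using real_over_mono[OF ab(1)] by blast
  then have "real_over P (A \<union> set b' \<union> set a) c"
    using reg_overD[OF P(1) sm_tuple[OF A ab(2)] _ _ ab(3) cb'] by blast
  then have "real_over P (A \<union> set a) c" by (rule real_over_mono) blast
  then show False using P(2) c ab(1) unfolding asym_over_def by blast
qed

text \<open>Here \<open>c\<close> is outside \<open>D(b1)\<close> but in \<open>D(b2)\<close>. The
  automorphism exchanging \<open>b1\<close> and \<open>b2\<close> gives \<open>c'\<close> outside
  \<open>D(b2)\<close> but in \<open>D(b1)\<close>, so regularity yields both \<open>c < c'\<close>
  and \<open>c' < c\<close>.\<close>

lemma nonorth_over_not_symmetric:
  assumes A: "sm A" and P: "reg_over A P" "asym_over A P" and Q: "invariant_over L M A Q"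
    and sym: "symmetric L M \<kappa> Q" and no: "nonorth_over A P Q"
  shows False
proof -
  have gP: "global_type L M P" and gQ: "global_type L M Q"
    using P(1) Q by (auto intro: reg_over_global invariant_over_global)
  have invP: "invariant_over L M A P" using P(1) by (simp add: reg_over_def)
  obtain b1 where b1: "real_over Q A b1" using ex_real_over[OF gQ A] .
  have Ab1: "sm (A \<union> set b1)" using sm_tuple[OF A b1] .
  obtain c where c: "real_over P (A \<union> set b1) c" using ex_real_over[OF gP Ab1] .
  \<comment> \<open>Choosing \<open>b2\<close> over \<open>c\<close> as well is what forces
    \<open>c\<close> into \<open>D(b2)\<close>.\<close>
  obtain b2 where b2: "real_over Q (A \<union> set b1 \<union> set c) b2"
    using ex_real_over[OF gQ sm_tuple[OF Ab1 c]] .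
  have cA: "real_over P A c" and b2c: "real_over Q (A \<union> set c) b2" and b2b1: "real_over Q (A \<union> set b1) b2"
    and b2A: "real_over Q A b2"
    using c b2 by (auto elim: real_over_mono)
  have b1b2: "real_over Q (A \<union> set b2) b1" using symmetricD[OF A Q sym b1 b2b1] .
  obtain g where g: "aut_over A g" "map g b1 = b2" "map g b2 = b1"
    using pair_homogeneous[OF A gQ Q order_refl b1 b2b1 b2A b1b2] .
  define c' where "c' = map g c"
  have c': "real_over P (A \<union> set b2) c'"
    using real_over_aut_Un[OF invP order_refl g(1) c] g(2) sm_univ[OF Ab1] by (simp add: c'_def)
  then have c'A: "real_over P A c'" by (rule real_over_mono) blast
  have b1c': "real_over Q (A \<union> set c') b1"
    using real_over_aut_Un[OF Q order_refl g(1) b2c] g(3) sm_univ[OF sm_tuple[OF A cA]] by (simp add: c'_def)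
  have n1: "\<not> real_over P (A \<union> set b2) c" using nonorth_not_real_over[OF A P Q no cA b2c] .
  have n2: "\<not> real_over P (A \<union> set b1) c'" using nonorth_not_real_over[OF A P Q no c'A b1c'] .
  have "real_over P (A \<union> set b2 \<union> set c) c'"
    using reg_overD[OF P(1) sm_tuple[OF A b2A] _ cA n1 c'] by blast
  then have 1: "real_over P (A \<union> set c) c'" by (rule real_over_mono) blast
  have "real_over P (A \<union> set b1 \<union> set c') c"
    using reg_overD[OF P(1) Ab1 _ c'A n2 c] by blast
  then have 2: "real_over P (A \<union> set c') c" by (rule real_over_mono) blast
  show False using P(2) cA 1 2 unfolding asym_over_def by blast
qed

text \<open>Over the base \<open>B\<close>, suppose \<open>a \<in> D(b)\<close>. Take
  \<open>b3\<close> realizing \<open>Q\<close> over \<open>B\<close> with \<open>a\<close> outside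
  \<open>D(b3)\<close>, and \<open>a3\<close> outside \<open>D(b)\<close> but in
  \<open>D(b3)\<close>. Then \<open>b\<close> gives \<open>a < a3\<close> and \<open>b3\<close>
  gives \<open>a3 < a\<close>.\<close>

lemma nonorth_real_over_extend:
  assumes B: "sm B" "A \<subseteq> B" and P: "reg_over A P" "asym_over A P" and Q: "reg_over A Q"
    and no: "nonorth_over A P Q"
    and a: "real_over P B a" and b: "real_over Q A b" "\<not> real_over Q B b"
  shows "real_over P (B \<union> set b) a"
proof (rule ccontr)
  assume neg: "\<not> real_over P (B \<union> set b) a"
  have PB: "reg_over B P" "asym_over B P" "nonorth_over B P Q"
    using P no B(2) by (auto intro: reg_over_mono asym_over_mono nonorth_over_mono)
  have invP: "invariant_over L M B P" and invQ: "invariant_over L M B Q"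
    using PB(1) reg_over_mono[OF Q B(2)] by (auto simp: reg_over_def)
  have gP: "global_type L M P" and gQ: "global_type L M Q" using P(1) Q by (auto intro: reg_over_global)
  have Bb: "sm (B \<union> set b)" using sm_tuple[OF B(1) b(1)] .
  \<comment> \<open>A pair with these properties is built first and then moved over \<open>B\<close>
    so that its second member becomes the given \<open>a\<close>.\<close>
  obtain b3 where b3: "real_over Q B b3" and ab3: "real_over P (B \<union> set b3) a"
  proof (atomize_elim)
    obtain b0 a0 where 0: "real_over Q B b0" "real_over P (B \<union> set b0) a0" using ex_pair[OF gQ gP B(1)] .
    have a0: "real_over P B a0" using real_over_mono[OF 0(2)] by blast
    obtain g where g: "aut_over B g" "map g a0 = a" using real_over_homogeneous[OF gP B(1) a0 a] .
    have "real_over Q B (map g b0)"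
      using real_over_aut_Un[OF invQ order_refl g(1), of "[]" b0] 0(1) sm_univ[OF B(1)] by simp
    moreover have "real_over P (B \<union> set (map g b0)) a"
      using real_over_aut_Un[OF invP order_refl g(1) 0(2)] g(2) sm_univ[OF sm_tuple[OF B(1) 0(1)]] by simp
    ultimately show "\<exists>b3. real_over Q B b3 \<and> real_over P (B \<union> set b3) a" by blast
  qed
  \<comment> \<open>The only use of regularity of \<open>Q\<close>: since \<open>b\<close> realizes
    \<open>Q\<close> over \<open>A\<close> but not over \<open>B\<close>, it does not affect
    \<open>b3\<close>.\<close>
  have b3b: "real_over Q (B \<union> set b) b3" using reg_overD[OF Q B b b3] .
  \<comment> \<open>Again a pair is built in the convenient order and moved, here over
    \<open>B\<close> and \<open>b\<close>, so that its second member becomes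
    \<open>b3\<close>.\<close>
  obtain a3 where a3: "real_over P (B \<union> set b) a3" and b3a3: "real_over Q (B \<union> set b \<union> set a3) b3"
  proof (atomize_elim)
    obtain a0 b0 where 0: "real_over P (B \<union> set b) a0" "real_over Q (B \<union> set b \<union> set a0) b0"
      using ex_pair[OF gP gQ Bb] .
    have b0: "real_over Q (B \<union> set b) b0" using real_over_mono[OF 0(2)] by blast
    obtain g where g: "aut_over (B \<union> set b) g" "map g b0 = b3"
      using real_over_homogeneous[OF gQ Bb b0 b3b] .
    have "real_over P (B \<union> set b) (map g a0)"
      using real_over_aut_Un[OF invP _ g(1), of "[]" a0] 0(1) sm_univ[OF Bb] by simp
    moreover have "real_over Q (B \<union> set b \<union> set (map g a0)) b3"
      using real_over_aut_Un[OF invQ _ g(1) 0(2)] g(2) sm_univ[OF sm_tuple[OF Bb 0(1)]] by simp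
    ultimately show "\<exists>a3. real_over P (B \<union> set b) a3 \<and> real_over Q (B \<union> set b \<union> set a3) b3" by blast
  qed
  have a3B: "real_over P B a3" using real_over_mono[OF a3] by blast
  have "real_over Q (B \<union> set a3) b3" using b3a3 by (rule real_over_mono) blast
  then have n3: "\<not> real_over P (B \<union> set b3) a3"
    by (rule nonorth_not_real_over[OF B(1) PB(1,2) invQ PB(3) a3B])
  have "real_over P (B \<union> set b \<union> set a) a3" using reg_overD[OF PB(1) Bb _ a neg a3] by blast
  then have 1: "real_over P (B \<union> set a) a3" by (rule real_over_mono) blast
  have "real_over P (B \<union> set b3 \<union> set a3) a"
    using reg_overD[OF PB(1) sm_tuple[OF B(1) b3] _ a3B n3 ab3] by blast
  then have 2: "real_over P (B \<union> set a3) a" by (rule real_over_mono) blast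
  show False using PB(2) a 1 2 unfolding asym_over_def by blast
qed

section \<open>Orthogonality to symmetric types, reflexivity and transitivity\<close>

lemma regular_asymmetric_orthogonal:
  assumes "regular L M \<kappa> P" "asymmetric L M \<kappa> P" "invariant L M \<kappa> Q" "symmetric L M \<kappa> Q"
  shows "orthogonal L M P Q"
proof (rule ccontr)
  assume no: "\<not> orthogonal L M P Q"
  obtain A1 where A1: "sm A1" "reg_over A1 P" using regularD[OF assms(1)] .
  obtain A2 where A2: "sm A2" "A1 \<subseteq> A2" "asym_over A2 P" using ex_asym_over[OF A1 assms(2)] .
  obtain A3 where A3: "sm A3" "invariant_over L M A3 Q" using assms(3) by (auto simp: invariant_def)
  let ?A = "A2 \<union> A3"
  have A: "sm ?A" using A2 A3 by (intro sm_Un)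
  have R: "reg_over ?A P" using A1(2) A2(2) by (auto elim: reg_over_mono)
  then have inv: "invariant_over L M ?A P" by (simp add: reg_over_def)
  obtain A4 where A4: "sm A4" "?A \<subseteq> A4" "nonorth_over A4 P Q"
    using ex_nonorth_over[OF A inv invariant_over_global[OF A3(2)] no] .
  show False
  proof (rule nonorth_over_not_symmetric[OF A4(1) _ _ _ assms(4) A4(3)])
    show "reg_over A4 P" using R A4(2) by (rule reg_over_mono)
    show "asym_over A4 P" using A2(3) A4(2) by (auto elim: asym_over_mono)
    show "invariant_over L M A4 Q" using A3(2) A4(2) by (auto elim: invariant_over_mono)
  qed
qed

lemma regular_global: "regular L M \<kappa> P \<Longrightarrow> global_type L M P"
  by (auto simp: regular_def regular_over_def invariant_over_def)

lemma regular_invariant: "regular L M \<kappa> P \<Longrightarrow> invariant L M \<kappa> P"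
  by (auto simp: regular_def regular_over_def invariant_def)

text \<open>Self-orthogonality would let the members of a pair realizing the product be exchanged by
  \<open>orthogonal_commute\<close>, which asymmetry forbids.\<close>

lemma asymmetric_not_orthogonal_self:
  assumes "regular L M \<kappa> P" "asymmetric L M \<kappa> P"
  shows "\<not> orthogonal L M P P"
proof
  assume orth: "orthogonal L M P P"
  have gP: "global_type L M P" using regular_global[OF assms(1)] .
  obtain A1 where A1: "sm A1" "reg_over A1 P" using regularD[OF assms(1)] .
  obtain A where A: "sm A" "A1 \<subseteq> A" "asym_over A P" using ex_asym_over[OF A1 assms(2)] .
  have inv: "invariant_over L M A P" using reg_over_mono[OF A1(2) A(2)] by (simp add: reg_over_def)
  obtain a b where ab: "real_over P A a" "real_over P (A \<union> set a) b" using ex_pair[OF gP gP A(1)] .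
  show False using orthogonal_commute[OF A(1) inv inv orth ab] A(3) ab unfolding asym_over_def by blast
qed

lemma nonorthogonal_trans:
  assumes P: "regular L M \<kappa> P" "asymmetric L M \<kappa> P" and Q: "regular L M \<kappa> Q" "asymmetric L M \<kappa> Q"
    and R: "regular L M \<kappa> R" and PQ: "\<not> orthogonal L M P Q" and QR: "\<not> orthogonal L M Q R"
  shows "\<not> orthogonal L M P R"
proof
  assume orth: "orthogonal L M P R"
  note g = P(1)[THEN regular_global] Q(1)[THEN regular_global] R[THEN regular_global]
  obtain A1 where A1: "sm A1" "reg_over A1 P" using regularD[OF P(1)] .
  obtain A2 where A2: "sm A2" "A1 \<subseteq> A2" "asym_over A2 P" using ex_asym_over[OF A1 P(2)] .
  obtain A3 where A3: "sm A3" "reg_over A3 Q" using regularD[OF Q(1)] .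
  obtain A4 where A4: "sm A4" "A3 \<subseteq> A4" "asym_over A4 Q" using ex_asym_over[OF A3 Q(2)] .
  obtain A5 where A5: "sm A5" "reg_over A5 R" using regularD[OF R] .
  have i1: "invariant_over L M A1 P" and i3: "invariant_over L M A3 Q"
    using A1(2) A3(2) by (auto simp: reg_over_def)
  obtain A6 where A6: "sm A6" "A1 \<subseteq> A6" "nonorth_over A6 P Q"
    using ex_nonorth_over[OF A1(1) i1 g(2) PQ] .
  obtain A7 where A7: "sm A7" "A3 \<subseteq> A7" "nonorth_over A7 Q R"
    using ex_nonorth_over[OF A3(1) i3 g(3) QR] .
  \<comment> \<open>A common base for all regularity, asymmetry and non-orthogonality statements;
    the local forms pass to it by monotonicity.\<close>
  define A where "A = A2 \<union> A4 \<union> A5 \<union> A6 \<union> A7"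
  have A: "sm A" unfolding A_def using A2 A4 A5 A6 A7 by (intro sm_Un)
  have sub: "A1 \<subseteq> A" "A2 \<subseteq> A" "A3 \<subseteq> A" "A4 \<subseteq> A" "A5 \<subseteq> A" "A6 \<subseteq> A" "A7 \<subseteq> A"
    using A2 A4 unfolding A_def by auto
  have reg: "reg_over A P" "reg_over A Q" "reg_over A R"
    using reg_over_mono A1(2) A3(2) A5(2) sub by blast+
  then have inv: "invariant_over L M A P" "invariant_over L M A Q" "invariant_over L M A R"
    by (auto simp: reg_over_def)
  have asy: "asym_over A P" "asym_over A Q" using asym_over_mono A2(3) A4(3) sub by blast+
  have no: "nonorth_over A P Q" "nonorth_over A Q R" using nonorth_over_mono A6(3) A7(3) sub by blast+
  obtain a b where ab: "real_over P A a" "real_over Q (A \<union> set a) b" using ex_pair[OF g(1,2) A] .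
  have Aab: "sm (A \<union> set a \<union> set b)" using sm_tuple[OF sm_tuple[OF A ab(1)] ab(2)] .
  obtain c where c: "real_over R (A \<union> set a \<union> set b) c" using ex_real_over[OF g(3) Aab] .
  have b: "real_over Q A b" and ca: "real_over R (A \<union> set a) c" and cb: "real_over R (A \<union> set b) c"
    using ab c by (auto elim: real_over_mono)
  have ac: "real_over P (A \<union> set c) a" using orthogonal_commute[OF A inv(1,3) orth ab(1) ca] .
  have bc: "\<not> real_over Q (A \<union> set c) b"
    using nonorth_not_real_over[OF A reg(2) asy(2) inv(3) no(2) b cb] .
  \<comment> \<open>The extension lemma is applied with \<open>A\<close> and \<open>c\<close> as the
    larger base: \<open>b\<close> realizes \<open>Q\<close> over \<open>A\<close> but no longer over
    this base.\<close>
  have "real_over P (A \<union> set c \<union> set b) a"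
    using nonorth_real_over_extend[OF sm_tuple[OF A ca] _ reg(1) asy(1) reg(2) no(1) ac b bc] by blast
  then have "real_over P (A \<union> set b) a" by (rule real_over_mono) blast
  then show False using nonorth_not_real_over[OF A reg(1) asy(1) inv(2) no(1) ab] by blast
qed

end

theorem theorem5p9:
  fixes L :: "('f, 'r) lang" and M :: "('f, 'r, 'a) fostruct" and \<kappa> :: "'k rel"
  assumes "monster L M \<kappa>"
  shows
    "(\<forall>P Q. regular L M \<kappa> P \<and> asymmetric L M \<kappa> P \<and> invariant L M \<kappa> Q \<and> symmetric L M \<kappa> Q
        \<longrightarrow> orthogonal L M P Q) \<and>
     (\<forall>P Q. regular L M \<kappa> P \<and> regular L M \<kappa> Q \<and> \<not> orthogonal L M P Q
        \<longrightarrow> (symmetric L M \<kappa> P \<longleftrightarrow> symmetric L M \<kappa> Q)) \<and>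
     equiv {P. regular L M \<kappa> P \<and> asymmetric L M \<kappa> P}
       {(P, Q). (regular L M \<kappa> P \<and> asymmetric L M \<kappa> P) \<and>
                (regular L M \<kappa> Q \<and> asymmetric L M \<kappa> Q) \<and> \<not> orthogonal L M P Q}"
proof -
  interpret monster_model L M \<kappa> by unfold_locales (rule assms)
  have sym: "orthogonal L M Q P" if "regular L M \<kappa> P" "regular L M \<kappa> Q" "orthogonal L M P Q" for P Q
    using orthogonal_sym that regular_global by blast
  show ?thesis
  proof (intro conjI allI impI)
    show "orthogonal L M P Q"
      if "regular L M \<kappa> P \<and> asymmetric L M \<kappa> P \<and> invariant L M \<kappa> Q \<and> symmetric L M \<kappa> Q" for P Q
      using that regular_asymmetric_orthogonal by simp
    show "symmetric L M \<kappa> P \<longleftrightarrow> symmetric L M \<kappa> Q"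
      if PQ: "regular L M \<kappa> P \<and> regular L M \<kappa> Q \<and> \<not> orthogonal L M P Q" for P Q
    proof -
      \<comment> \<open>A regular type is invariant, so (i) applies in either direction: if exactly
        one of the two types were symmetric, the other one would be orthogonal to it.\<close>
      have "\<not> orthogonal L M Q P" using PQ sym[of Q P] by blast
      then show ?thesis
        using PQ regular_asymmetric_orthogonal[of P Q] regular_asymmetric_orthogonal[of Q P]
          regular_invariant[of P] regular_invariant[of Q] unfolding asymmetric_def by blast
    qed
    show "equiv {P. regular L M \<kappa> P \<and> asymmetric L M \<kappa> P}
       {(P, Q). (regular L M \<kappa> P \<and> asymmetric L M \<kappa> P) \<and>
                (regular L M \<kappa> Q \<and> asymmetric L M \<kappa> Q) \<and> \<not> orthogonal L M P Q}" (is "equiv ?A ?r")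
    proof (rule equivI)
      show "refl_on ?A ?r"
        using asymmetric_not_orthogonal_self by (auto simp: refl_on_def)
      show "Relation.sym ?r" using sym by (auto simp: Relation.sym_def)
      show "trans ?r"
      proof (rule transI)
        show "(P, R) \<in> ?r" if "(P, Q) \<in> ?r" "(Q, R) \<in> ?r" for P Q R
          using that nonorthogonal_trans[of P Q R] by simp
      qed
    qed auto
  qed
qed

end
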